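(* Let $\tilde\pi$ be the adjusted bid-ask process associated with $\pi$ (defined in the context) and let $\tilde{\mathcal{A}}$ be its cone of attainable claims. Then $\mathcal{A}\subseteq\tilde{\mathcal{A}}\subseteq\bar{\mathcal{A}}$. Moreover, either $\tilde{\mathcal{A}}$ contains an arbitrage, or $\tilde{\mathcal{A}}$ is arbitrage-free and closed in $\mathcal{L}^0_T$. In the former case $\bar{\mathcal{A}}$ also contains an arbitrage, while in the latter case $\bar{\mathcal{A}}=\tilde{\mathcal{A}}$.
   Context: Let $(\Omega,\mathcal{F},(\mathcal{F}_t)_{t=0,1,\dots,T},\mathbb{P})$ be a filtered probability space and $d\ge 1$ an integer. $\mathcal{L}^0_t$ is the space of $\mathbb{R}^d$-valued $\mathcal{F}_t$-measurable random variables (identified when a.s. equal) with the topology of convergence in probability, and $\mathcal{L}^{0,+}_t$ the subset of those with non-negative components. For a (suitably measurable) random set $S$, $\mathcal{L}^0(S;\mathcal{F}_t)$ is the set of $\mathcal{F}_t$-measurable random variables taking values a.s. in $S$. A $d\times d$ real matrix $\Pi$ is a bid-ask matrix if $\Pi^{ij}>0$, $\Pi^{ii}=1$ and $\Pi^{ij}\Pi^{jk}\ge\Pi^{ik}$ for all $i,j,k$. A bid-ask process is an adapted $\mathbb{R}^{d\times d}$-valued process $(\pi_t)_{t=0,\dots,T}$ with each $\pi_t$ a bid-ask matrix; fix one, $\pi$. For a matrix $\Pi$ with positive entries and $\Pi^{ii}=1$ let $K(\Pi)\subset\mathbb{R}^d$ be the convex cone spanned by the canonical basis vectors $e_i$ ($1\le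 i\le d$) and the vectors $\Pi^{ij}e_i-e_j$ ($1\le i,j\le d$). Put $-\mathcal{K}_t:=\mathcal{L}^0(-K(\pi_t);\mathcal{F}_t)$ and $\mathcal{A}:=(-\mathcal{K}_0)+\dots+(-\mathcal{K}_T)\subseteq\mathcal{L}^0_T$. $\bar{\mathcal{A}}$ denotes the closure of $\mathcal{A}$ in $\mathcal{L}^0_T$. A cone $\mathcal{B}\subseteq\mathcal{L}^0_T$ is arbitrage-free if $\mathcal{B}\cap\mathcal{L}^{0,+}_T=\{0\}$; otherwise it contains an arbitrage. Adjusted bid-ask process: for each $i,j,t$ put $z^{i,j}_t:=e_j-\pi^{ij}_t e_i$ and $R^{i,j}_t:=\{B\in\mathcal{F}_t:\ -z^{i,j}_t 1_B\in\bar{\mathcal{A}}\}$. The collection $R^{i,j}_t$ is closed under countable unions and has a $\mathbb{P}$-a.s. maximum, denoted $B^{i,j}_t$, i.e. $B^{i,j}_t\in R^{i,j}_t$ and every $B\in R^{i,j}_t$ with $B^{i,j}_t\subseteq B$ satisfies $\mathbb{P}(B\setminus B^{i,j}_t)=0$. For $i\ne j$ define $$\tilde\pi^{j,i}_t:=\frac{1}{\pi^{ij}_t}1_{B^{i,j}_t}+\pi^{ji}_t 1_{(B^{i,j}_t)^c},$$ and $\tilde\pi^{i,i}_t:=1$. (The process $\tilde\pi$ need not satisfy $\tilde\pi^{ik}\le\tilde\pi^{ij}\tilde\pi^{jk}$.) Its trading cones are $-\tilde{\mathcal{K}}_t:=\mathcal{L}^0(-K(\tilde\pi_t);\mathcal{F}_t)$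 and its cone of attainable claims is $\tilde{\mathcal{A}}:=(-\tilde{\mathcal{K}}_0)+\dots+(-\tilde{\mathcal{K}}_T)$. *)

theory Defs
  imports "HOL-Probability.Probability"
begin

section \<open>Random vectors and convergence in probability\<close>

text \<open>
  Random vectors are represented by functions on the sample space rather than by classes of
  a.s. equal functions. Every set of random vectors used below (random variables with values in a
  random set, attainable claims, closures, non-negative claims) is, within the \<open>\<L>\<^sup>0\<close> it lives in,
  closed under replacing an element by an a.s. equal one, so inclusions, equalities and
  closedness have the same meaning as for the sets of classes; the element \<open>0\<close> of \<open>\<L>\<^sup>0\<close> becomes the set of
  measurable functions that vanish a.s.

  Throughout, \<open>M\<close> is the ambient probability space and carries the measure; of a member \<open>G\<close> of the
  filtration only the \<open>\<sigma>\<close>-algebra is used.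
\<close>

definition filtration_upto :: "'a measure \<Rightarrow> (nat \<Rightarrow> 'a measure) \<Rightarrow> nat \<Rightarrow> bool" where
  "filtration_upto M F T \<longleftrightarrow>
     (\<forall>t\<le>T. subalgebra M (F t)) \<and> (\<forall>s t. s \<le> t \<longrightarrow> t \<le> T \<longrightarrow> sets (F s) \<subseteq> sets (F t))"

definition L0 :: "'a measure \<Rightarrow> ('a \<Rightarrow> real ^ 'n) set" where
  "L0 G = borel_measurable G"

definition L0_in :: "'a measure \<Rightarrow> 'a measure \<Rightarrow> ('a \<Rightarrow> (real ^ 'n) set) \<Rightarrow> ('a \<Rightarrow> real ^ 'n) set" where
  "L0_in M G S = {X \<in> L0 G. AE \<omega> in M. X \<omega> \<in> S \<omega>}"

definition L0_nonneg :: "'a measure \<Rightarrow> 'a measure \<Rightarrow> ('a \<Rightarrow> real ^ 'n) set" where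
  "L0_nonneg M G = {X \<in> L0 G. AE \<omega> in M. \<forall>i. 0 \<le> X \<omega> $ i}"

definition L0_zero :: "'a measure \<Rightarrow> 'a measure \<Rightarrow> ('a \<Rightarrow> real ^ 'n) set" where
  "L0_zero M G = {X \<in> L0 G. AE \<omega> in M. X \<omega> = 0}"

definition prob_nhd :: "'a measure \<Rightarrow> 'a measure \<Rightarrow> ('a \<Rightarrow> real ^ 'n) \<Rightarrow> real \<Rightarrow> ('a \<Rightarrow> real ^ 'n) set" where
  "prob_nhd M G X \<epsilon> = {Y \<in> L0 G. measure M {\<omega> \<in> space M. \<epsilon> < dist (X \<omega>) (Y \<omega>)} < \<epsilon>}"

text \<open>
  The sets \<open>prob_nhd M G X \<epsilon>\<close> with \<open>\<epsilon> > 0\<close> form a neighbourhood base at \<open>X\<close>. That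
  convergence of sequences in this topology is convergence in probability is
  \<open>limitin_L0_topology\<close> below.
\<close>

definition L0_topology :: "'a measure \<Rightarrow> 'a measure \<Rightarrow> ('a \<Rightarrow> real ^ 'n) topology" where
  "L0_topology M G =
     topology (\<lambda>U. U \<subseteq> L0 G \<and> (\<forall>X\<in>U. \<exists>\<epsilon>>0. prob_nhd M G X \<epsilon> \<subseteq> U))"

definition arbitrage_free :: "'a measure \<Rightarrow> 'a measure \<Rightarrow> ('a \<Rightarrow> real ^ 'n) set \<Rightarrow> bool" where
  "arbitrage_free M G \<B> \<longleftrightarrow> \<B> \<inter> L0_nonneg M G = L0_zero M G"

abbreviation contains_arbitrage :: "'a measure \<Rightarrow> 'a measure \<Rightarrow> ('a \<Rightarrow> real ^ 'n) set \<Rightarrow> bool" where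
  "contains_arbitrage M G \<B> \<equiv> \<not> arbitrage_free M G \<B>"


section \<open>Bid-ask processes and attainable claims\<close>

text \<open>The entry \<open>P\<^sup>i\<^sup>j\<close> is \<open>P $ i $ j\<close>.\<close>

definition bid_ask_matrix :: "real ^ 'n ^ 'n \<Rightarrow> bool" where
  "bid_ask_matrix P \<longleftrightarrow>
     (\<forall>i j. 0 < P $ i $ j) \<and> (\<forall>i. P $ i $ i = 1) \<and>
     (\<forall>i j k. P $ i $ k \<le> P $ i $ j * P $ j $ k)"

definition bid_ask_process ::
  "'a measure \<Rightarrow> (nat \<Rightarrow> 'a measure) \<Rightarrow> nat \<Rightarrow> (nat \<Rightarrow> 'a \<Rightarrow> real ^ 'n ^ 'n) \<Rightarrow> bool" where
  "bid_ask_process M F T \<pi> \<longleftrightarrow>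
     (\<forall>t\<le>T. \<pi> t \<in> borel_measurable (F t) \<and> (\<forall>\<omega>\<in>space M. bid_ask_matrix (\<pi> t \<omega>)))"

definition solvency_cone :: "real ^ 'n ^ 'n \<Rightarrow> (real ^ 'n) set" where
  "solvency_cone P =
     convex_cone hull
       (range (\<lambda>i. axis i 1) \<union> {P $ i $ j *\<^sub>R axis i 1 - axis j 1 |i j. True})"

definition trading_cone ::
  "'a measure \<Rightarrow> (nat \<Rightarrow> 'a measure) \<Rightarrow> (nat \<Rightarrow> 'a \<Rightarrow> real ^ 'n ^ 'n) \<Rightarrow> nat \<Rightarrow> ('a \<Rightarrow> real ^ 'n) set" where
  "trading_cone M F \<pi> t = L0_in M (F t) (\<lambda>\<omega>. uminus ` solvency_cone (\<pi> t \<omega>))"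

definition attainable ::
  "'a measure \<Rightarrow> (nat \<Rightarrow> 'a measure) \<Rightarrow> nat \<Rightarrow> (nat \<Rightarrow> 'a \<Rightarrow> real ^ 'n ^ 'n) \<Rightarrow> ('a \<Rightarrow> real ^ 'n) set" where
  "attainable M F T \<pi> =
     {(\<lambda>\<omega>. \<Sum>t\<le>T. \<xi> t \<omega>) |\<xi>. \<forall>t\<le>T. \<xi> t \<in> trading_cone M F \<pi> t}"

definition attainable_closure ::
  "'a measure \<Rightarrow> (nat \<Rightarrow> 'a measure) \<Rightarrow> nat \<Rightarrow> (nat \<Rightarrow> 'a \<Rightarrow> real ^ 'n ^ 'n) \<Rightarrow> ('a \<Rightarrow> real ^ 'n) set" where
  "attainable_closure M F T \<pi> = L0_topology M (F T) closure_of attainable M F T \<pi>"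


section \<open>The adjusted bid-ask process\<close>

definition exchange ::
  "(nat \<Rightarrow> 'a \<Rightarrow> real ^ 'n ^ 'n) \<Rightarrow> nat \<Rightarrow> 'n \<Rightarrow> 'n \<Rightarrow> 'a \<Rightarrow> real ^ 'n" where
  "exchange \<pi> t i j \<omega> = axis j 1 - \<pi> t \<omega> $ i $ j *\<^sub>R axis i 1"

definition reversible_sets ::
  "'a measure \<Rightarrow> (nat \<Rightarrow> 'a measure) \<Rightarrow> nat \<Rightarrow> (nat \<Rightarrow> 'a \<Rightarrow> real ^ 'n ^ 'n) \<Rightarrow>
     nat \<Rightarrow> 'n \<Rightarrow> 'n \<Rightarrow> 'a set set" where
  "reversible_sets M F T \<pi> t i j =
     {B \<in> sets (F t). (\<lambda>\<omega>. - (indicator B \<omega> *\<^sub>R exchange \<pi> t i j \<omega>)) \<in> attainable_closure M F T \<pi>}"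

text \<open>
  A maximal reversible set is only unique up to null sets, so the choice of these sets is a
  parameter of the adjusted process. Such a choice always exists, see
  \<open>maximal_reversible_exists\<close> below.
\<close>

definition maximal_reversible ::
  "'a measure \<Rightarrow> (nat \<Rightarrow> 'a measure) \<Rightarrow> nat \<Rightarrow> (nat \<Rightarrow> 'a \<Rightarrow> real ^ 'n ^ 'n) \<Rightarrow>
     (nat \<Rightarrow> 'n \<Rightarrow> 'n \<Rightarrow> 'a set) \<Rightarrow> bool" where
  "maximal_reversible M F T \<pi> B \<longleftrightarrow>
     (\<forall>t\<le>T. \<forall>i j. B t i j \<in> reversible_sets M F T \<pi> t i j \<and>
        (\<forall>C\<in>reversible_sets M F T \<pi> t i j. B t i j \<subseteq> C \<longrightarrow> measure M (C - B t i j) = 0))"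

text \<open>Note the transposition: the entry \<open>j,i\<close> is governed by \<open>B t i j\<close>.\<close>

definition adjusted_process ::
  "(nat \<Rightarrow> 'a \<Rightarrow> real ^ 'n ^ 'n) \<Rightarrow> (nat \<Rightarrow> 'n \<Rightarrow> 'n \<Rightarrow> 'a set) \<Rightarrow> nat \<Rightarrow> 'a \<Rightarrow> real ^ 'n ^ 'n" where
  "adjusted_process \<pi> B t \<omega> =
     (\<chi> j i. if i = j then 1
             else if \<omega> \<in> B t i j then 1 / \<pi> t \<omega> $ i $ j
             else \<pi> t \<omega> $ j $ i)"


section \<open>Properties of the topology\<close>

lemma L0_subalgebra: "subalgebra M G \<Longrightarrow> X \<in> L0 G \<Longrightarrow> X \<in> borel_measurable M"
  unfolding L0_def by (rule measurable_from_subalg)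

lemma prob_nhd_self: "0 < \<epsilon> \<Longrightarrow> X \<in> L0 G \<Longrightarrow> X \<in> prob_nhd M G X \<epsilon>"
  by (simp add: prob_nhd_def)

lemma (in prob_space) prob_dist_add:
  fixes X Y X1 Y1 X2 Y2 :: "'a \<Rightarrow> real ^ 'n"
  assumes [measurable]: "X1 \<in> borel_measurable M" "Y1 \<in> borel_measurable M"
      "X2 \<in> borel_measurable M" "Y2 \<in> borel_measurable M"
    and le: "\<And>\<omega>. dist (X \<omega>) (Y \<omega>) \<le> dist (X1 \<omega>) (Y1 \<omega>) + dist (X2 \<omega>) (Y2 \<omega>)"
    and 1: "prob {\<omega> \<in> space M. a < dist (X1 \<omega>) (Y1 \<omega>)} < a"
    and 2: "prob {\<omega> \<in> space M. b < dist (X2 \<omega>) (Y2 \<omega>)} < b"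
  shows "prob {\<omega> \<in> space M. a + b < dist (X \<omega>) (Y \<omega>)} < a + b"
proof -
  let ?A = "{\<omega> \<in> space M. a < dist (X1 \<omega>) (Y1 \<omega>)}"
  let ?B = "{\<omega> \<in> space M. b < dist (X2 \<omega>) (Y2 \<omega>)}"
  have "{\<omega> \<in> space M. a + b < dist (X \<omega>) (Y \<omega>)} \<subseteq> ?A \<union> ?B"
    using le by (auto simp: not_less) (smt (verit))
  then have "prob {\<omega> \<in> space M. a + b < dist (X \<omega>) (Y \<omega>)} \<le> prob (?A \<union> ?B)"
    by (intro finite_measure_mono) auto
  also have "\<dots> \<le> prob ?A + prob ?B"
    by (rule measure_Un_le) measurable
  finally show ?thesis using 1 2 by linarith
qed

lemma prob_nhd_mono:
  assumes "prob_space M" "subalgebra M G" "X \<in> L0 G" "a \<le> b"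
  shows "prob_nhd M G X a \<subseteq> prob_nhd M G X b"
proof
  interpret prob_space M by fact
  fix Y assume Y: "Y \<in> prob_nhd M G X a"
  then have [measurable]: "X \<in> borel_measurable M" "Y \<in> borel_measurable M"
    using assms L0_subalgebra by (auto simp: prob_nhd_def)
  have "prob {\<omega> \<in> space M. b < dist (X \<omega>) (Y \<omega>)} \<le> prob {\<omega> \<in> space M. a < dist (X \<omega>) (Y \<omega>)}"
    using assms(4) by (intro finite_measure_mono) auto
  then show "Y \<in> prob_nhd M G X b" using Y assms(4) by (auto simp: prob_nhd_def)
qed

lemma prob_nhd_trans:
  assumes "prob_space M" "subalgebra M G" "X \<in> L0 G"
    and "Y \<in> prob_nhd M G X a" "Z \<in> prob_nhd M G Y b"
  shows "Z \<in> prob_nhd M G X (a + b)"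
proof -
  interpret prob_space M by fact
  have [measurable]: "X \<in> borel_measurable M" "Y \<in> borel_measurable M" "Z \<in> borel_measurable M"
    using assms L0_subalgebra by (auto simp: prob_nhd_def)
  show ?thesis
    using assms prob_dist_add[of X Y Y Z X Z a b] by (auto simp: prob_nhd_def dist_triangle)
qed

lemma openin_L0_topology:
  fixes U :: "('a \<Rightarrow> real ^ 'n) set"
  assumes "prob_space M" "subalgebra M G"
  shows "openin (L0_topology M G) U \<longleftrightarrow>
           U \<subseteq> L0 G \<and> (\<forall>X\<in>U. \<exists>\<epsilon>>0. prob_nhd M G X \<epsilon> \<subseteq> U)"
proof -
  have "istopology (\<lambda>U :: ('a \<Rightarrow> real ^ 'n) set. U \<subseteq> L0 G \<and> (\<forall>X\<in>U. \<exists>\<epsilon>>0. prob_nhd M G X \<epsilon> \<subseteq> U))"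
    unfolding istopology_def
  proof (intro conjI allI impI ballI)
    fix S U X
    assume S: "S \<subseteq> L0 G \<and> (\<forall>X\<in>S. \<exists>\<epsilon>>0. prob_nhd M G X \<epsilon> \<subseteq> S)"
      and U: "U \<subseteq> L0 G \<and> (\<forall>X\<in>U. \<exists>\<epsilon>>0. prob_nhd M G X \<epsilon> \<subseteq> U)" and X: "X \<in> S \<inter> U"
    from S U X obtain a b where ab: "a > 0" "prob_nhd M G X a \<subseteq> S" "b > 0" "prob_nhd M G X b \<subseteq> U"
      by blast
    have "X \<in> L0 G" using S X by auto
    then have "prob_nhd M G X (min a b) \<subseteq> S \<inter> U"
      using ab prob_nhd_mono[OF assms, of X "min a b" a] prob_nhd_mono[OF assms, of X "min a b" b]
      by auto
    then show "\<exists>\<epsilon>>0. prob_nhd M G X \<epsilon> \<subseteq> S \<inter> U"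
      using ab by (intro exI[of _ "min a b"]) auto
  qed (auto, (metis Union_upper subset_trans)+)
  then show ?thesis unfolding L0_topology_def by (simp add: topology_inverse')
qed

lemma topspace_L0_topology:
  assumes "prob_space M" "subalgebra M G"
  shows "topspace (L0_topology M G) = L0 G"
proof
  show "topspace (L0_topology M G) \<subseteq> L0 G"
    using openin_topspace[of "L0_topology M G"] unfolding openin_L0_topology[OF assms] by blast
  have "openin (L0_topology M G) (L0 G)"
    unfolding openin_L0_topology[OF assms] by (auto simp: prob_nhd_def intro: exI[of _ 1])
  then show "L0 G \<subseteq> topspace (L0_topology M G)" by (rule openin_subset)
qed

lemma prob_nhd_open_inside:
  assumes "prob_space M" "subalgebra M G" "X \<in> L0 G" "0 < \<epsilon>"
  obtains U where "openin (L0_topology M G) U" "X \<in> U" "U \<subseteq> prob_nhd M G X \<epsilon>"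
proof -
  define U where "U = {Y \<in> L0 G. \<exists>\<delta>>0. prob_nhd M G Y \<delta> \<subseteq> prob_nhd M G X \<epsilon>}"
  have "\<exists>a>0. prob_nhd M G Y a \<subseteq> U" if "Y \<in> U" for Y
  proof -
    from that obtain \<delta> where \<delta>: "\<delta> > 0" "prob_nhd M G Y \<delta> \<subseteq> prob_nhd M G X \<epsilon>" "Y \<in> L0 G"
      by (auto simp: U_def)
    have "prob_nhd M G Z (\<delta>/2) \<subseteq> prob_nhd M G X \<epsilon>" if "Z \<in> prob_nhd M G Y (\<delta>/2)" for Z
      using prob_nhd_trans[OF assms(1,2) \<delta>(3) that] \<delta>(2) by fastforce
    moreover have "prob_nhd M G Y (\<delta>/2) \<subseteq> L0 G" by (auto simp: prob_nhd_def)
    ultimately have "prob_nhd M G Y (\<delta>/2) \<subseteq> U"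
      using half_gt_zero[OF \<delta>(1)] unfolding U_def by blast
    then show ?thesis using \<delta>(1) half_gt_zero by blast
  qed
  then have "openin (L0_topology M G) U"
    unfolding openin_L0_topology[OF assms(1,2)] by (auto simp: U_def)
  moreover have "X \<in> U" using assms by (auto simp: U_def)
  moreover have "U \<subseteq> prob_nhd M G X \<epsilon>" using prob_nhd_self unfolding U_def by blast
  ultimately show ?thesis by (rule that)
qed

lemma closure_of_L0_topology:
  assumes "prob_space M" "subalgebra M G"
  shows "X \<in> L0_topology M G closure_of S \<longleftrightarrow>
           X \<in> L0 G \<and> (\<forall>\<epsilon>>0. \<exists>Y\<in>S. Y \<in> prob_nhd M G X \<epsilon>)"
proof -
  note top = topspace_L0_topology[OF assms] and opn = openin_L0_topology[OF assms]
  show ?thesis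
  proof safe
    assume X: "X \<in> L0_topology M G closure_of S"
    then show "X \<in> L0 G" by (simp add: in_closure_of top)
    fix \<epsilon> :: real assume "0 < \<epsilon>"
    then obtain U where "openin (L0_topology M G) U" "X \<in> U" "U \<subseteq> prob_nhd M G X \<epsilon>"
      using prob_nhd_open_inside[OF assms \<open>X \<in> L0 G\<close>] by blast
    then show "\<exists>Y\<in>S. Y \<in> prob_nhd M G X \<epsilon>" using X unfolding in_closure_of by blast
  next
    assume "X \<in> L0 G" "\<forall>\<epsilon>>0. \<exists>Y\<in>S. Y \<in> prob_nhd M G X \<epsilon>"
    then show "X \<in> L0_topology M G closure_of S"
      unfolding in_closure_of top opn by blast
  qed
qed

lemma limitin_L0_topology:
  fixes Xs :: "nat \<Rightarrow> 'a \<Rightarrow> real ^ 'n"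
  assumes "prob_space M" "subalgebra M G" "\<And>n. Xs n \<in> L0 G" "X \<in> L0 G"
  shows "limitin (L0_topology M G) Xs X sequentially \<longleftrightarrow>
           (\<forall>\<epsilon>>0. (\<lambda>n. measure M {\<omega> \<in> space M. \<epsilon> < dist (X \<omega>) (Xs n \<omega>)}) \<longlonglongrightarrow> 0)"
proof -
  interpret prob_space M by fact
  have [measurable]: "X \<in> borel_measurable M" "Xs n \<in> borel_measurable M" for n
    using assms L0_subalgebra by auto
  have "limitin (L0_topology M G) Xs X sequentially \<longleftrightarrow>
          (\<forall>\<epsilon>>0. \<forall>\<^sub>F n in sequentially. Xs n \<in> prob_nhd M G X \<epsilon>)"
  proof safe
    fix \<epsilon> :: real assume "limitin (L0_topology M G) Xs X sequentially" "0 < \<epsilon>"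
    moreover obtain U where U: "openin (L0_topology M G) U" "X \<in> U" "U \<subseteq> prob_nhd M G X \<epsilon>"
      by (rule prob_nhd_open_inside[OF assms(1,2,4) \<open>0 < \<epsilon>\<close>])
    ultimately have "\<forall>\<^sub>F n in sequentially. Xs n \<in> U"
      unfolding limitin_def by blast
    then show "\<forall>\<^sub>F n in sequentially. Xs n \<in> prob_nhd M G X \<epsilon>"
      by (rule eventually_mono) (use U(3) in blast)
  next
    assume *: "\<forall>\<epsilon>>0. \<forall>\<^sub>F n in sequentially. Xs n \<in> prob_nhd M G X \<epsilon>"
    show "limitin (L0_topology M G) Xs X sequentially"
      unfolding limitin_def topspace_L0_topology[OF assms(1,2)] openin_L0_topology[OF assms(1,2)]
    proof (intro conjI allI impI)
      fix U assume "(U \<subseteq> L0 G \<and> (\<forall>X\<in>U. \<exists>\<epsilon>>0. prob_nhd M G X \<epsilon> \<subseteq> U)) \<and> X \<in> U"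
      then obtain \<epsilon> where \<epsilon>: "0 < \<epsilon>" "prob_nhd M G X \<epsilon> \<subseteq> U" by blast
      have "\<forall>\<^sub>F n in sequentially. Xs n \<in> prob_nhd M G X \<epsilon>" using * \<epsilon>(1) by simp
      then show "\<forall>\<^sub>F n in sequentially. Xs n \<in> U"
        by (rule eventually_mono) (use \<epsilon>(2) in blast)
    qed (fact assms(4))
  qed
  also have "\<dots> \<longleftrightarrow>
    (\<forall>\<epsilon>>0. (\<lambda>n. measure M {\<omega> \<in> space M. \<epsilon> < dist (X \<omega>) (Xs n \<omega>)}) \<longlonglongrightarrow> 0)"
  proof safe
    fix \<epsilon> :: real
    assume *: "\<forall>\<epsilon>>0. \<forall>\<^sub>F n in sequentially. Xs n \<in> prob_nhd M G X \<epsilon>" and "0 < \<epsilon>"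
    show "(\<lambda>n. measure M {\<omega> \<in> space M. \<epsilon> < dist (X \<omega>) (Xs n \<omega>)}) \<longlonglongrightarrow> 0"
    proof (rule order_tendstoI)
      fix a :: real assume "0 < a"
      then have "\<forall>\<^sub>F n in sequentially. Xs n \<in> prob_nhd M G X (min a \<epsilon>)"
        using * \<open>0 < \<epsilon>\<close> by simp
      then show "\<forall>\<^sub>F n in sequentially. measure M {\<omega> \<in> space M. \<epsilon> < dist (X \<omega>) (Xs n \<omega>)} < a"
      proof eventually_elim
        case (elim n)
        have "measure M {\<omega> \<in> space M. \<epsilon> < dist (X \<omega>) (Xs n \<omega>)}
            \<le> measure M {\<omega> \<in> space M. min a \<epsilon> < dist (X \<omega>) (Xs n \<omega>)}"
          by (intro finite_measure_mono) auto
        then show ?case using elim by (auto simp: prob_nhd_def)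
      qed
    next
      fix a :: real assume "a < 0"
      then show "\<forall>\<^sub>F n in sequentially. a < measure M {\<omega> \<in> space M. \<epsilon> < dist (X \<omega>) (Xs n \<omega>)}"
        by (intro always_eventually allI) (rule less_le_trans[OF _ measure_nonneg])
    qed
  next
    fix \<epsilon> :: real
    assume "\<forall>\<epsilon>>0. (\<lambda>n. measure M {\<omega> \<in> space M. \<epsilon> < dist (X \<omega>) (Xs n \<omega>)}) \<longlonglongrightarrow> 0" and "0 < \<epsilon>"
    then have "\<forall>\<^sub>F n in sequentially. measure M {\<omega> \<in> space M. \<epsilon> < dist (X \<omega>) (Xs n \<omega>)} < \<epsilon>"
      by (intro order_tendstoD) auto
    then show "\<forall>\<^sub>F n in sequentially. Xs n \<in> prob_nhd M G X \<epsilon>"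
      using assms(3) by (auto simp: prob_nhd_def)
  qed
  finally show ?thesis .
qed


section \<open>Existence of maximal reversible sets\<close>

lemma convex_cone_solvency_cone: "convex_cone (solvency_cone P)"
  unfolding solvency_cone_def by (rule convex_cone_convex_cone_hull)

lemma trading_cone_add:
  assumes "X \<in> trading_cone M F \<pi> t" "Y \<in> trading_cone M F \<pi> t"
  shows "(\<lambda>\<omega>. X \<omega> + Y \<omega>) \<in> trading_cone M F \<pi> t"
proof -
  have *: "x + y \<in> uminus ` solvency_cone P"
    if "x \<in> uminus ` solvency_cone P" "y \<in> uminus ` solvency_cone P" for x y and P :: "real ^ 'b ^ 'b"
  proof -
    from that obtain u v where "u \<in> solvency_cone P" "v \<in> solvency_cone P" "x = - u" "y = - v" by auto
    then show ?thesis
      using convex_cone_add[OF convex_cone_solvency_cone, of u P v] by (intro image_eqI[of _ _ "u + v"]) auto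
  qed
  show ?thesis using assms unfolding trading_cone_def L0_in_def L0_def by (auto intro: *)
qed

lemma trading_cone_zero: "(\<lambda>\<omega>. 0) \<in> trading_cone M F \<pi> t"
proof -
  have "0 \<in> uminus ` solvency_cone P" for P :: "real ^ 'b ^ 'b"
    using convex_cone_contains_0[OF convex_cone_solvency_cone, of P] by (metis image_eqI minus_zero)
  then show ?thesis by (auto simp: trading_cone_def L0_in_def L0_def)
qed

lemma attainable_add:
  assumes "X \<in> attainable M F T \<pi>" "Y \<in> attainable M F T \<pi>"
  shows "(\<lambda>\<omega>. X \<omega> + Y \<omega>) \<in> attainable M F T \<pi>"
proof -
  from assms obtain \<xi> \<eta> where "\<forall>t\<le>T. \<xi> t \<in> trading_cone M F \<pi> t" "\<forall>t\<le>T. \<eta> t \<in> trading_cone M F \<pi> t"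
    "X = (\<lambda>\<omega>. \<Sum>t\<le>T. \<xi> t \<omega>)" "Y = (\<lambda>\<omega>. \<Sum>t\<le>T. \<eta> t \<omega>)" by (auto simp: attainable_def)
  then show ?thesis
    unfolding attainable_def
    by (auto intro!: exI[of _ "\<lambda>t \<omega>. \<xi> t \<omega> + \<eta> t \<omega>"] simp: sum.distrib trading_cone_add)
qed

lemma trading_cone_subset_attainable:
  assumes "t \<le> T" "X \<in> trading_cone M F \<pi> t"
  shows "X \<in> attainable M F T \<pi>"
proof -
  have "X = (\<lambda>\<omega>. \<Sum>s\<le>T. (if s = t then X else (\<lambda>\<omega>. 0)) \<omega>)"
    using assms(1) by (auto simp: if_distrib[of "\<lambda>f. f _"] sum.delta cong: if_cong)
  then show ?thesis unfolding attainable_def using assms(2) trading_cone_zero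
    by (auto intro!: exI[of _ "\<lambda>s. if s = t then X else (\<lambda>\<omega>. 0)"])
qed

lemma attainable_subset_L0:
  assumes "filtration_upto M F T"
  shows "attainable M F T (\<pi> :: nat \<Rightarrow> 'a \<Rightarrow> real ^ 'b ^ 'b) \<subseteq> L0 (F T)"
proof -
  have "X \<in> L0 (F T)" if "t \<le> T" "X \<in> trading_cone M F \<pi> t" for t and X :: "'a \<Rightarrow> real ^ 'b"
  proof -
    have "subalgebra (F T) (F t)"
      using assms that by (auto simp: filtration_upto_def subalgebra_def)
    then show ?thesis
      using that by (auto simp: trading_cone_def L0_in_def L0_def intro: measurable_from_subalg)
  qed
  note tc = this
  show ?thesis
  proof
    fix X :: "'a \<Rightarrow> real ^ 'b" assume "X \<in> attainable M F T \<pi>"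
    then obtain \<xi> where "\<forall>t\<le>T. \<xi> t \<in> trading_cone M F \<pi> t" and X: "X = (\<lambda>\<omega>. \<Sum>t\<le>T. \<xi> t \<omega>)"
      by (auto simp: attainable_def)
    then have "\<xi> t \<in> borel_measurable (F T)" if "t \<le> T" for t
      using tc that by (auto simp: L0_def)
    then show "X \<in> L0 (F T)" unfolding X L0_def by (intro borel_measurable_sum) auto
  qed
qed

lemma exchange_indicator_measurable:
  fixes \<pi> :: "nat \<Rightarrow> 'a \<Rightarrow> real ^ 'n ^ 'n"
  assumes "bid_ask_process M F T \<pi>" "t \<le> T" "C \<in> sets (F t)"
  shows "(\<lambda>\<omega>. indicator C \<omega> *\<^sub>R exchange \<pi> t i j \<omega>) \<in> borel_measurable (F t)"
proof -
  have \<pi>: "\<pi> t \<in> borel_measurable (F t)" using assms by (auto simp: bid_ask_process_def)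
  have "(\<lambda>x :: real ^ 'n ^ 'n. x $ i $ j) \<in> borel_measurable borel"
    by (intro borel_measurable_continuous_onI continuous_intros)
  from measurable_compose[OF \<pi> this] have [measurable]: "(\<lambda>\<omega>. \<pi> t \<omega> $ i $ j) \<in> borel_measurable (F t)" .
  note [measurable] = assms(3)
  show ?thesis unfolding exchange_def by measurable
qed

lemma exchange_attainable:
  fixes \<pi> :: "nat \<Rightarrow> 'a \<Rightarrow> real ^ 'n ^ 'n"
  assumes "bid_ask_process M F T \<pi>" "t \<le> T" "C \<in> sets (F t)"
  shows "(\<lambda>\<omega>. indicator C \<omega> *\<^sub>R exchange \<pi> t i j \<omega>) \<in> attainable M F T \<pi>"
proof (rule trading_cone_subset_attainable[OF assms(2)])
  have "indicator C \<omega> *\<^sub>R exchange \<pi> t i j \<omega> \<in> uminus ` solvency_cone (\<pi> t \<omega>)" for \<omega>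
  proof -
    have "- exchange \<pi> t i j \<omega> \<in> solvency_cone (\<pi> t \<omega>)"
      unfolding solvency_cone_def by (rule hull_inc) (auto simp: exchange_def)
    moreover have "0 \<in> solvency_cone (\<pi> t \<omega>)"
      by (rule convex_cone_contains_0[OF convex_cone_solvency_cone])
    ultimately show ?thesis
      by (cases "\<omega> \<in> C") (auto intro: image_eqI[of _ _ "- exchange \<pi> t i j \<omega>"] image_eqI[of _ _ 0])
  qed
  then show "(\<lambda>\<omega>. indicator C \<omega> *\<^sub>R exchange \<pi> t i j \<omega>) \<in> trading_cone M F \<pi> t"
    using exchange_indicator_measurable[OF assms] by (auto simp: trading_cone_def L0_in_def L0_def)
qed

lemma attainable_closure_add:
  fixes \<pi> :: "nat \<Rightarrow> 'a \<Rightarrow> real ^ 'n ^ 'n"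
  assumes "prob_space M" "filtration_upto M F T"
    and X: "X \<in> attainable_closure M F T \<pi>" and Y: "Y \<in> attainable_closure M F T \<pi>"
  shows "(\<lambda>\<omega>. X \<omega> + Y \<omega>) \<in> attainable_closure M F T \<pi>"
proof -
  interpret prob_space M by fact
  have sub: "subalgebra M (F T)" using assms by (auto simp: filtration_upto_def)
  note cl = closure_of_L0_topology[OF assms(1) sub]
  have XY: "X \<in> L0 (F T)" "Y \<in> L0 (F T)" using X Y by (auto simp: attainable_closure_def cl)
  note [measurable] = XY[THEN L0_subalgebra[OF sub]]
  have "\<exists>Z\<in>attainable M F T \<pi>. Z \<in> prob_nhd M (F T) (\<lambda>\<omega>. X \<omega> + Y \<omega>) \<epsilon>" if "0 < \<epsilon>" for \<epsilon>
  proof -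
    have "0 < \<epsilon>/2" using that by simp
    then obtain X' Y' where *: "X' \<in> attainable M F T \<pi>" "X' \<in> prob_nhd M (F T) X (\<epsilon>/2)"
        "Y' \<in> attainable M F T \<pi>" "Y' \<in> prob_nhd M (F T) Y (\<epsilon>/2)"
      using X Y unfolding attainable_closure_def cl by blast
    then have L: "X' \<in> L0 (F T)" "Y' \<in> L0 (F T)" by (auto simp: prob_nhd_def)
    note [measurable] = L[THEN L0_subalgebra[OF sub]]
    have "measure M {\<omega> \<in> space M. \<epsilon>/2 + \<epsilon>/2 < dist (X \<omega> + Y \<omega>) (X' \<omega> + Y' \<omega>)} < \<epsilon>/2 + \<epsilon>/2"
      by (rule prob_dist_add[of X X' Y Y'])
        (use * in \<open>auto simp: prob_nhd_def intro: dist_triangle_add\<close>)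
    moreover have "(\<lambda>\<omega>. X' \<omega> + Y' \<omega>) \<in> L0 (F T)" using L by (auto simp: L0_def)
    ultimately have "(\<lambda>\<omega>. X' \<omega> + Y' \<omega>) \<in> prob_nhd M (F T) (\<lambda>\<omega>. X \<omega> + Y \<omega>) \<epsilon>"
      by (simp add: prob_nhd_def)
    then show ?thesis using attainable_add * by blast
  qed
  then show ?thesis using XY unfolding attainable_closure_def cl by (auto simp: L0_def)
qed

lemma attainable_subset_closure:
  assumes "prob_space M" "filtration_upto M F T"
  shows "attainable M F T \<pi> \<subseteq> attainable_closure M F T \<pi>"
proof -
  have sub: "subalgebra M (F T)" using assms by (auto simp: filtration_upto_def)
  show ?thesis
    unfolding attainable_closure_def using attainable_subset_L0[OF assms(2)]
    by (intro closure_of_subset) (simp add: topspace_L0_topology[OF assms(1) sub])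
qed

lemma reversible_Un:
  fixes \<pi> :: "nat \<Rightarrow> 'a \<Rightarrow> real ^ 'n ^ 'n"
  assumes "prob_space M" "filtration_upto M F T" "bid_ask_process M F T \<pi>" "t \<le> T"
    and B: "B \<in> reversible_sets M F T \<pi> t i j" and C: "C \<in> reversible_sets M F T \<pi> t i j"
  shows "B \<union> C \<in> reversible_sets M F T \<pi> t i j"
proof -
  have "B \<inter> C \<in> sets (F t)" using B C by (auto simp: reversible_sets_def)
  then have "(\<lambda>\<omega>. indicator (B \<inter> C) \<omega> *\<^sub>R exchange \<pi> t i j \<omega>) \<in> attainable_closure M F T \<pi>"
    using exchange_attainable[OF assms(3,4)] attainable_subset_closure[OF assms(1,2)] by blast
  moreover have "(\<lambda>\<omega>. - (indicator B \<omega> *\<^sub>R exchange \<pi> t i j \<omega>)) \<in> attainable_closure M F T \<pi>"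
    "(\<lambda>\<omega>. - (indicator C \<omega> *\<^sub>R exchange \<pi> t i j \<omega>)) \<in> attainable_closure M F T \<pi>"
    using B C by (auto simp: reversible_sets_def)
  ultimately have "(\<lambda>\<omega>. (- (indicator B \<omega> *\<^sub>R exchange \<pi> t i j \<omega>) + - (indicator C \<omega> *\<^sub>R exchange \<pi> t i j \<omega>))
      + indicator (B \<inter> C) \<omega> *\<^sub>R exchange \<pi> t i j \<omega>) \<in> attainable_closure M F T \<pi>"
    by (intro attainable_closure_add[OF assms(1,2)])
  also have "(\<lambda>\<omega>. (- (indicator B \<omega> *\<^sub>R exchange \<pi> t i j \<omega>) + - (indicator C \<omega> *\<^sub>R exchange \<pi> t i j \<omega>))
      + indicator (B \<inter> C) \<omega> *\<^sub>R exchange \<pi> t i j \<omega>)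
      = (\<lambda>\<omega>. - (indicator (B \<union> C) \<omega> *\<^sub>R exchange \<pi> t i j \<omega>))"
    by (rule ext) (auto simp: indicator_def)
  finally show ?thesis using B C by (auto simp: reversible_sets_def)
qed

lemma reversible_UN:
  fixes \<pi> :: "nat \<Rightarrow> 'a \<Rightarrow> real ^ 'n ^ 'n"
  assumes "prob_space M" "filtration_upto M F T" "bid_ask_process M F T \<pi>" "t \<le> T"
    and B: "\<And>n :: nat. B n \<in> reversible_sets M F T \<pi> t i j"
  shows "(\<Union>n. B n) \<in> reversible_sets M F T \<pi> t i j"
proof -
  interpret prob_space M by fact
  have sub: "subalgebra M (F T)" "subalgebra M (F t)" "subalgebra (F T) (F t)"
    using assms by (auto simp: filtration_upto_def subalgebra_def)
  define U where "U n = (\<Union>k\<le>n. B k)" for n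
  have UR: "U n \<in> reversible_sets M F T \<pi> t i j" for n
  proof (induction n)
    case 0 then show ?case using B by (simp add: U_def)
  next
    case (Suc n)
    have "U (Suc n) = U n \<union> B (Suc n)" by (auto simp: U_def atMost_Suc)
    then show ?case using reversible_Un[OF assms(1-4) Suc B] by simp
  qed
  have sets: "U n \<in> sets (F t)" "(\<Union>n. B n) \<in> sets (F t)" for n
    using UR B by (auto simp: reversible_sets_def)
  then have setsM: "U n \<in> sets M" "(\<Union>n. B n) \<in> sets M" for n
    using sub by (auto simp: subalgebra_def)
  let ?V = "\<Union>n. B n"
  let ?f = "\<lambda>A \<omega>. - (indicator A \<omega> *\<^sub>R exchange \<pi> t i j \<omega>)"
  have fL: "?f A \<in> L0 (F T)" if "A \<in> sets (F t)" for A
    using measurable_from_subalg[OF sub(3) exchange_indicator_measurable[OF assms(3,4) that]]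
    by (auto simp: L0_def)
  have UV: "(\<Union>n. U n) = ?V" by (auto simp: U_def)
  have "(\<lambda>n. prob (?V - U n)) \<longlonglongrightarrow> prob (\<Inter>n. ?V - U n)"
    using setsM by (intro finite_Lim_measure_decseq decseq_SucI) (auto simp: U_def)
  moreover have "(\<Inter>n. ?V - U n) = {}" using UV by blast
  ultimately have lim: "(\<lambda>n. prob (?V - U n)) \<longlonglongrightarrow> 0" by (simp only: measure_empty)
  have "\<exists>Y\<in>attainable M F T \<pi>. Y \<in> prob_nhd M (F T) (?f ?V) \<epsilon>" if "0 < \<epsilon>" for \<epsilon>
  proof -
    have \<epsilon>: "0 < \<epsilon>/2" using that by simp
    have "\<forall>\<^sub>F n in sequentially. prob (?V - U n) < \<epsilon>/2"
      by (rule order_tendstoD(2)[OF lim \<epsilon>])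
    then obtain n where n: "prob (?V - U n) < \<epsilon>/2"
      by (auto simp: eventually_sequentially)
    have "{\<omega> \<in> space M. \<epsilon>/2 < dist (?f ?V \<omega>) (?f (U n) \<omega>)} \<subseteq> ?V - U n"
      using \<epsilon> by (auto simp: indicator_def U_def split: if_splits)
    then have "prob {\<omega> \<in> space M. \<epsilon>/2 < dist (?f ?V \<omega>) (?f (U n) \<omega>)} \<le> prob (?V - U n)"
      using setsM by (intro finite_measure_mono) auto
    then have 1: "?f (U n) \<in> prob_nhd M (F T) (?f ?V) (\<epsilon>/2)"
      using n fL[OF sets(1)] by (simp add: prob_nhd_def)
    have "?f (U n) \<in> attainable_closure M F T \<pi>" using UR by (auto simp: reversible_sets_def)
    then obtain Y where Y: "Y \<in> attainable M F T \<pi>" "Y \<in> prob_nhd M (F T) (?f (U n)) (\<epsilon>/2)"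
      unfolding attainable_closure_def closure_of_L0_topology[OF assms(1) sub(1)] using \<epsilon> by blast
    show ?thesis
      using prob_nhd_trans[OF assms(1) sub(1) fL[OF sets(2)] 1 Y(2)] Y(1) by auto
  qed
  then have "?f ?V \<in> attainable_closure M F T \<pi>"
    unfolding attainable_closure_def closure_of_L0_topology[OF assms(1) sub(1)] using fL[OF sets(2)] by blast
  then show ?thesis using sets by (auto simp: reversible_sets_def)
qed

lemma maximal_reversible_exists:
  fixes \<pi> :: "nat \<Rightarrow> 'a \<Rightarrow> real ^ 'n ^ 'n"
  assumes "prob_space M" "filtration_upto M F T" "bid_ask_process M F T \<pi>"
  shows "\<exists>B. maximal_reversible M F T \<pi> B"
proof -
  interpret prob_space M by fact
  have "\<exists>B\<in>reversible_sets M F T \<pi> t i j.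
      \<forall>C\<in>reversible_sets M F T \<pi> t i j. B \<subseteq> C \<longrightarrow> prob (C - B) = 0" if t: "t \<le> T" for t i j
  proof -
    let ?R = "reversible_sets M F T \<pi> t i j"
    have "(\<lambda>\<omega>. indicator {} \<omega> *\<^sub>R exchange \<pi> t i j \<omega>) \<in> attainable_closure M F T \<pi>"
      using exchange_attainable[OF assms(3) t, of "{}"] attainable_subset_closure[OF assms(1,2)] by blast
    then have ne: "{} \<in> ?R" by (simp add: reversible_sets_def)
    have RM: "C \<in> sets M" if "C \<in> ?R" for C
      using that t assms(2) by (auto simp: reversible_sets_def filtration_upto_def subalgebra_def)
    have bdd: "bdd_above (prob ` ?R)" by (auto intro: bdd_aboveI[of _ 1])
    let ?s = "Sup (prob ` ?R)"
    have "\<exists>C\<in>?R. ?s - 1 / Suc n < prob C" for n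
      using less_cSup_iff[OF _ bdd, of "?s - 1 / Suc n"] ne by auto
    then obtain B where B: "\<And>n. B n \<in> ?R" "\<And>n. ?s - 1 / Suc n < prob (B n)" by metis
    have V: "(\<Union>n. B n) \<in> ?R" by (rule reversible_UN[OF assms t B(1)])
    have "?s \<le> prob (\<Union>n. B n)"
    proof (rule field_le_epsilon)
      fix e :: real assume "0 < e"
      then obtain n where n: "1 / Suc n < e" using nat_approx_posE by blast
      have "prob (B n) \<le> prob (\<Union>n. B n)" using RM[OF V] by (intro finite_measure_mono) auto
      then show "?s \<le> prob (\<Union>n. B n) + e" using B(2)[of n] n by linarith
    qed
    moreover have "prob C \<le> ?s" if "C \<in> ?R" for C using that bdd by (auto intro: cSup_upper)
    ultimately have "prob (C - (\<Union>n. B n)) = 0" if "C \<in> ?R" "(\<Union>n. B n) \<subseteq> C" for C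
      using that RM V finite_measure_Diff[of C "\<Union>n. B n"] measure_nonneg[of M "C - (\<Union>n. B n)"]
      by (smt (verit))
    then show ?thesis using V by blast
  qed
  then have "\<exists>B. \<forall>t i j. t \<le> T \<longrightarrow> B t i j \<in> reversible_sets M F T \<pi> t i j \<and>
      (\<forall>C\<in>reversible_sets M F T \<pi> t i j. B t i j \<subseteq> C \<longrightarrow> prob (C - B t i j) = 0)"
    by metis
  then show ?thesis unfolding maximal_reversible_def by blast
qed

end

theory Submission
  imports Defs
begin

text \<open>
  Where a trade from \<open>i\<close> to \<open>j\<close> can be reversed in the closure, the adjusted rates make it
  reversible in the adjusted market itself; elsewhere, by maximality of \<open>B t i j\<close>, no multiple of it
  can be reversed even in the closure. If the adjusted market is arbitrage-free, its claims are
  therefore a finite sum of lines (reversible trades) and rays (all other generators), and any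
  strategy with zero outcome has vanishing ray components. Such a sum is closed, by induction over
  the generators in chronological order: where the coefficients of the first generator stay
  bounded, a random subsequence of them converges; where they do not, normalising shows that the
  negative of the generator lies in the sum of the remaining ones, so that a ray vanishes there and
  a line is absorbed by the remaining sum.
\<close>

text \<open>A sum of cones need not be closed: bounded outcomes may come from unbounded positions
  that nearly cancel. In the limit such a cancellation produces a strategy with zero outcome. The
  proof arranges that these strategies form a linear space, so that they can be subtracted with
  coefficients of either sign. The chronological order is forced by adaptedness: multipliers and
  random indices computed from the coefficients of one generator are applied to all later
  coefficients, so they must be measurable for every later \<sigma>-algebra. Vanishing of rays comes
  from two sources. Absence of arbitrage handles the disposals \<open>- axis i 1\<close>. For
  exchanges the source is maximality of \<open>B t i j\<close>, which speaks about the closure of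
  the original claims; hence the adjusted claims are placed inside that closure before closedness is
  attacked. An exchange counts as reversible as soon as one of its two directions is: the product of
  the two adjusted rates is then at most 1, and what a round trip gains can be thrown away.\<close>

section \<open>Almost sure convergence and closed sets\<close>

text \<open>For subsets of \<open>L0 G\<close> this is closedness in the topology of convergence in
  probability, restated so that limits can be handled path by path.\<close>

definition ae_closed :: "'a measure \<Rightarrow> 'a measure \<Rightarrow> ('a \<Rightarrow> real ^ 'n) set \<Rightarrow> bool" where
  "ae_closed M G S \<longleftrightarrow>
     (\<forall>Xs X. (\<forall>n. Xs n \<in> S) \<longrightarrow> X \<in> L0 G \<longrightarrow>
        (AE \<omega> in M. (\<lambda>n. Xs n \<omega>) \<longlonglongrightarrow> X \<omega>) \<longrightarrow> X \<in> S)"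

lemma ae_closedD:
  assumes "ae_closed M G S" "\<And>n. Xs n \<in> S" "X \<in> L0 G" "AE \<omega> in M. (\<lambda>n. Xs n \<omega>) \<longlonglongrightarrow> X \<omega>"
  shows "X \<in> S"
  using assms unfolding ae_closed_def by blast

text \<open>The radii \<open>(1/2)^n\<close> are summable, so by Borel-Cantelli the approximants
  a.s. end up within \<open>(1/2)^n\<close> of the limit.\<close>

lemma closure_of_L0_imp_AE_limit:
  fixes X :: "'a \<Rightarrow> real ^ 'n"
  assumes "prob_space M" "subalgebra M G" "X \<in> L0_topology M G closure_of S"
  obtains Xs where "\<And>n. Xs n \<in> S" "AE \<omega> in M. (\<lambda>n. Xs n \<omega>) \<longlonglongrightarrow> X \<omega>"
proof -
  interpret prob_space M by fact
  note cl = closure_of_L0_topology[OF assms(1,2)]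
  have "\<forall>n::nat. \<exists>Y\<in>S. Y \<in> prob_nhd M G X ((1/2)^n)"
    using assms(3) unfolding cl by simp
  then obtain Xs where Xs: "\<And>n. Xs n \<in> S" "\<And>n. Xs n \<in> prob_nhd M G X ((1/2)^n)"
    by metis
  have [measurable]: "X \<in> borel_measurable M" "Xs n \<in> borel_measurable M" for n
    using assms(3) Xs(2)[of n] L0_subalgebra[OF assms(2)] unfolding cl prob_nhd_def by auto
  define A where "A n = {\<omega> \<in> space M. (1/2)^n < dist (X \<omega>) (Xs n \<omega>)}" for n
  have [measurable]: "A n \<in> sets M" for n unfolding A_def by measurable
  have "prob (A n) \<le> (1/2)^n" for n using Xs(2)[of n] by (simp add: prob_nhd_def A_def)
  then have "summable (\<lambda>n. prob (A n))"
    by (intro summable_comparison_test'[OF summable_geometric[of "1/2::real"]]) auto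
  then have "AE \<omega> in M. eventually (\<lambda>n. \<omega> \<in> space M - A n) sequentially"
    by (intro borel_cantelli_AE1) (auto simp: less_top[symmetric])
  then have "AE \<omega> in M. (\<lambda>n. Xs n \<omega>) \<longlonglongrightarrow> X \<omega>"
  proof eventually_elim
    case (elim \<omega>)
    have "\<forall>\<^sub>F n in sequentially. dist (Xs n \<omega>) (X \<omega>) \<le> (1/2)^n"
      using elim by eventually_elim (auto simp: A_def dist_commute)
    moreover have "(\<lambda>n. (1/2::real)^n) \<longlonglongrightarrow> 0" by (rule LIMSEQ_realpow_zero) auto
    ultimately show ?case
      by (subst tendsto_dist_iff) (rule tendsto_sandwich[of "\<lambda>_. 0"], auto)
  qed
  then show ?thesis using that Xs(1) by blast
qed

lemma AE_limit_in_closure_of_L0: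
  fixes X :: "'a \<Rightarrow> real ^ 'n"
  assumes "prob_space M" "subalgebra M G" "S \<subseteq> L0 G"
    and "\<And>n. Xs n \<in> S" "X \<in> L0 G" and lim: "AE \<omega> in M. (\<lambda>n. Xs n \<omega>) \<longlonglongrightarrow> X \<omega>"
  shows "X \<in> L0_topology M G closure_of S"
proof -
  interpret prob_space M by fact
  have [measurable]: "X \<in> borel_measurable M" "Xs n \<in> borel_measurable M" for n
    using assms L0_subalgebra by blast+
  have "\<exists>Y\<in>S. Y \<in> prob_nhd M G X \<epsilon>" if \<epsilon>: "0 < \<epsilon>" for \<epsilon>
  proof -
    define A where "A n = {\<omega> \<in> space M. \<epsilon> < dist (X \<omega>) (Xs n \<omega>)}" for n
    have [measurable]: "A n \<in> sets M" for n unfolding A_def by measurable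
    have "(\<lambda>n. \<integral>\<omega>. indicator (A n) \<omega> \<partial>M) \<longlonglongrightarrow> (\<integral>\<omega>. (0::real) \<partial>M)"
    proof (rule integral_dominated_convergence[where w = "\<lambda>_. 1"])
      show "AE \<omega> in M. (\<lambda>n. indicator (A n) \<omega> :: real) \<longlonglongrightarrow> 0"
        using lim
      proof eventually_elim
        case (elim \<omega>)
        have "\<forall>\<^sub>F n in sequentially. dist (Xs n \<omega>) (X \<omega>) < \<epsilon>"
          using tendstoD[OF elim \<epsilon>] .
        then have "\<forall>\<^sub>F n in sequentially. indicator (A n) \<omega> = (0::real)"
          by eventually_elim (auto simp: A_def dist_commute)
        then show ?case by (rule tendsto_eventually)
      qed
    qed (auto simp: indicator_def)
    then have "(\<lambda>n. prob (A n)) \<longlonglongrightarrow> 0" by simp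
    from order_tendstoD(2)[OF this \<epsilon>] obtain n where "prob (A n) < \<epsilon>"
      by (auto simp: eventually_sequentially)
    then show ?thesis using assms unfolding prob_nhd_def A_def by blast
  qed
  then show ?thesis using assms(5) unfolding closure_of_L0_topology[OF assms(1,2)] by blast
qed

lemma ae_closed_closure_of_L0:
  fixes S :: "('a \<Rightarrow> real ^ 'n) set"
  assumes "prob_space M" "subalgebra M G"
  shows "ae_closed M G (L0_topology M G closure_of S)"
proof -
  have "L0_topology M G closure_of S \<subseteq> L0 G"
    using closure_of_subset_topspace[of "L0_topology M G" S] by (simp add: topspace_L0_topology[OF assms])
  then show ?thesis
    unfolding ae_closed_def
    using AE_limit_in_closure_of_L0[OF assms, of "L0_topology M G closure_of S"]
    by simp blast
qed

lemma closedin_L0_topologyI: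
  fixes S :: "('a \<Rightarrow> real ^ 'n) set"
  assumes "prob_space M" "subalgebra M G" "S \<subseteq> L0 G" "ae_closed M G S"
  shows "closedin (L0_topology M G) S"
proof -
  have "L0_topology M G closure_of S \<subseteq> S"
  proof
    fix X assume X: "X \<in> L0_topology M G closure_of S"
    then obtain Xs where "\<And>n. Xs n \<in> S" "AE \<omega> in M. (\<lambda>n. Xs n \<omega>) \<longlonglongrightarrow> X \<omega>"
      using closure_of_L0_imp_AE_limit[OF assms(1,2) X] by blast
    moreover have "X \<in> L0 G" using X by (simp add: closure_of_L0_topology[OF assms(1,2)])
    ultimately show "X \<in> S" using ae_closedD[OF assms(4)] by blast
  qed
  moreover have "S \<subseteq> topspace (L0_topology M G)"
    using assms(3) by (simp add: topspace_L0_topology[OF assms(1,2)])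
  ultimately show ?thesis
    using closure_of_subset_eq by blast
qed

text \<open>A measurable Bolzano-Weierstrass theorem. The limsup \<open>L\<close> is a measurable
  cluster point, and the least index from \<open>k\<close> on with error below
  \<open>1 / Suc k\<close> is a measurable choice.\<close>

lemma bounded_random_subsequence:
  fixes \<alpha> :: "nat \<Rightarrow> 'a \<Rightarrow> real"
  assumes [measurable]: "\<And>n. \<alpha> n \<in> borel_measurable G"
    and bdd: "\<And>\<omega>. bounded (range (\<lambda>n. \<alpha> n \<omega>))"
  obtains \<tau> L where "\<And>k. \<tau> k \<in> measurable G (count_space (UNIV :: nat set))"
    "L \<in> borel_measurable G" "\<And>k \<omega>. k \<le> \<tau> k \<omega>" "\<And>\<omega>. (\<lambda>k. \<alpha> (\<tau> k \<omega>) \<omega>) \<longlonglongrightarrow> L \<omega>"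
proof -
  \<comment> \<open>The limsup is taken in \<open>ereal\<close>, where it always exists; boundedness
    makes it finite, so \<open>real_of_ereal\<close> loses nothing.\<close>
  define L where "L \<omega> = real_of_ereal (limsup (\<lambda>n. ereal (\<alpha> n \<omega>)))" for \<omega>
  define P where "P k \<omega> n \<longleftrightarrow> k \<le> n \<and> \<bar>\<alpha> n \<omega> - L \<omega>\<bar> < 1 / Suc k" for k \<omega> n
  define \<tau> where "\<tau> k \<omega> = (LEAST n. P k \<omega> n)" for k \<omega>
  have L[measurable]: "L \<in> borel_measurable G" unfolding L_def by measurable
  have "\<tau> k \<in> measurable G (count_space UNIV)" for k unfolding \<tau>_def P_def by measurable
  moreover have "P k \<omega> (\<tau> k \<omega>)" for k \<omega>
  proof -
    \<comment> \<open>A subsequence attaining the limsup supplies an index satisfying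
      \<open>P k \<omega>\<close>, so that the \<open>LEAST\<close> is meaningful.\<close>
    obtain r where r: "strict_mono r" "((\<lambda>n. ereal (\<alpha> n \<omega>)) \<circ> r) \<longlonglongrightarrow> limsup (\<lambda>n. ereal (\<alpha> n \<omega>))"
      using limsup_subseq_lim by blast
    obtain K where K: "\<And>n. \<bar>\<alpha> n \<omega>\<bar> \<le> K" using bdd[of \<omega>] by (auto simp: bounded_iff)
    have "((\<lambda>n. ereal (\<alpha> n \<omega>)) \<circ> r) n \<le> ereal K" "ereal (-K) \<le> ((\<lambda>n. ereal (\<alpha> n \<omega>)) \<circ> r) n" for n
      using K[of "r n"] by auto
    then have "limsup (\<lambda>n. ereal (\<alpha> n \<omega>)) \<le> ereal K" "ereal (-K) \<le> limsup (\<lambda>n. ereal (\<alpha> n \<omega>))"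
      using LIMSEQ_le_const2[OF r(2)] LIMSEQ_le_const[OF r(2)] by blast+
    then have "limsup (\<lambda>n. ereal (\<alpha> n \<omega>)) = ereal (L \<omega>)"
      unfolding L_def by (cases "limsup (\<lambda>n. ereal (\<alpha> n \<omega>))") auto
    then have "(\<lambda>n. \<alpha> (r n) \<omega>) \<longlonglongrightarrow> L \<omega>" using r(2) by (simp add: o_def)
    then have "\<forall>\<^sub>F n in sequentially. dist (\<alpha> (r n) \<omega>) (L \<omega>) < 1 / Suc k"
      by (rule tendstoD) simp
    moreover have "\<forall>\<^sub>F n in sequentially. k \<le> r n"
      using filterlim_subseq[OF r(1)] by (simp add: filterlim_at_top)
    ultimately have "\<forall>\<^sub>F n in sequentially. P k \<omega> (r n)"
      by eventually_elim (auto simp: P_def dist_real_def)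
    then have "\<exists>n. P k \<omega> n" by (auto simp: eventually_sequentially)
    then show ?thesis unfolding \<tau>_def by (rule LeastI_ex)
  qed
  moreover have "(\<lambda>k. \<alpha> (\<tau> k \<omega>) \<omega>) \<longlonglongrightarrow> L \<omega>" if "\<And>k. P k \<omega> (\<tau> k \<omega>)" for \<omega>
  proof (rule LIM_zero_cancel, rule tendsto_rabs_zero_cancel,
      rule tendsto_sandwich[of "\<lambda>_. 0" _ _ "\<lambda>k. 1 / Suc k"])
    show "(\<lambda>k. 1 / real (Suc k)) \<longlonglongrightarrow> 0" by (rule LIMSEQ_Suc[OF lim_1_over_n])
  qed (use that in \<open>auto simp: P_def less_imp_le\<close>)
  ultimately show ?thesis using that[of \<tau> L] L unfolding P_def by blast
qed

text \<open>The chosen indices need not increase strictly; \<open>k \<le> \<tau> k\<close> is enough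
  to pass to limits.\<close>

lemma filterlim_random_subsequence:
  assumes "\<And>k. k \<le> \<tau> k" "X \<longlonglongrightarrow> x"
  shows "(\<lambda>k. X (\<tau> k :: nat)) \<longlonglongrightarrow> x"
proof (rule filterlim_compose[OF assms(2)])
  show "filterlim \<tau> sequentially sequentially"
    by (rule filterlim_at_top_mono[OF filterlim_ident]) (simp add: assms(1))
qed


section \<open>Finite sums of lines and rays\<close>

text \<open>The flag of an entry is \<open>True\<close> for a line and \<open>False\<close> for a ray.\<close>

fun gen_cone ::
  "'a measure \<Rightarrow> 'a measure \<Rightarrow> ('a measure \<times> ('a \<Rightarrow> real ^ 'n) \<times> bool) list \<Rightarrow> ('a \<Rightarrow> real ^ 'n) set" where
  "gen_cone M H [] = L0_zero M H"
| "gen_cone M H ((G, g, b) # l) =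
     {(\<lambda>\<omega>. \<alpha> \<omega> *\<^sub>R g \<omega> + Y \<omega>) |\<alpha> Y.
        \<alpha> \<in> borel_measurable G \<and> (b \<or> (\<forall>\<omega>. 0 \<le> \<alpha> \<omega>)) \<and> Y \<in> gen_cone M H l}"

text \<open>The head carries the coarsest \<sigma>-algebra, so a factor or index known to it keeps
  every later coefficient measurable. Generators themselves need only be measurable at the end, for
  \<open>H\<close>.\<close>

fun chronological :: "'a measure \<Rightarrow> ('a measure \<times> ('a \<Rightarrow> real ^ 'n) \<times> bool) list \<Rightarrow> bool" where
  "chronological H [] \<longleftrightarrow> True"
| "chronological H ((G, g, b) # l) \<longleftrightarrow>
     subalgebra H G \<and> g \<in> borel_measurable H \<and> (\<forall>x\<in>set l. subalgebra (fst x) G) \<and>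
     chronological H l"

lemma gen_cone_ConsE:
  assumes "X \<in> gen_cone M H ((G, g, b) # l)"
  obtains \<alpha> Y where "\<alpha> \<in> borel_measurable G" "b \<or> (\<forall>\<omega>. 0 \<le> \<alpha> \<omega>)" "Y \<in> gen_cone M H l"
    "X = (\<lambda>\<omega>. \<alpha> \<omega> *\<^sub>R g \<omega> + Y \<omega>)"
  using assms by auto

lemma gen_cone_ConsE_seq:
  assumes "\<And>n::nat. X n \<in> gen_cone M H ((G, g, b) # l)"
  shows "\<exists>\<alpha> Y. \<forall>n. \<alpha> n \<in> borel_measurable G \<and> (b \<or> (\<forall>\<omega>. 0 \<le> \<alpha> n \<omega>)) \<and> Y n \<in> gen_cone M H l \<and>
    X n = (\<lambda>\<omega>. \<alpha> n \<omega> *\<^sub>R g \<omega> + Y n \<omega>)"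
proof -
  have "\<exists>\<alpha> Y. \<alpha> \<in> borel_measurable G \<and> (b \<or> (\<forall>\<omega>. 0 \<le> \<alpha> \<omega>)) \<and> Y \<in> gen_cone M H l \<and>
      X n = (\<lambda>\<omega>. \<alpha> \<omega> *\<^sub>R g \<omega> + Y \<omega>)" for n
    using assms[of n] by auto
  from choice[OF allI[OF this]] obtain \<alpha> where
    "\<forall>n. \<exists>Y. \<alpha> n \<in> borel_measurable G \<and> (b \<or> (\<forall>\<omega>. 0 \<le> \<alpha> n \<omega>)) \<and> Y \<in> gen_cone M H l \<and>
      X n = (\<lambda>\<omega>. \<alpha> n \<omega> *\<^sub>R g \<omega> + Y \<omega>)" ..
  from choice[OF this] show ?thesis by (rule exI[of _ \<alpha>])
qed

lemma gen_cone_ConsI: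
  assumes "\<alpha> \<in> borel_measurable G" "b \<or> (\<forall>\<omega>. 0 \<le> \<alpha> \<omega>)" "Y \<in> gen_cone M H l"
    "\<And>\<omega>. X \<omega> = \<alpha> \<omega> *\<^sub>R g \<omega> + Y \<omega>"
  shows "X \<in> gen_cone M H ((G, g, b) # l)"
  using assms by (auto simp: fun_eq_iff)

declare gen_cone.simps(2) [simp del]

section \<open>Elementary properties of sums of generators\<close>

lemma gen_cone_measurable:
  assumes "chronological H l" "X \<in> gen_cone M H l"
  shows "X \<in> borel_measurable H"
  using assms
proof (induction l arbitrary: X)
  case Nil
  then show ?case by (simp add: L0_zero_def L0_def)
next
  case (Cons x l)
  obtain G g b where x: "x = (G, g, b)" by (cases x)
  from Cons.prems(2) obtain \<alpha> Y where *: "\<alpha> \<in> borel_measurable G" "Y \<in> gen_cone M H l"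
    "X = (\<lambda>\<omega>. \<alpha> \<omega> *\<^sub>R g \<omega> + Y \<omega>)" unfolding x by (elim gen_cone_ConsE)
  have "subalgebra H G" "g \<in> borel_measurable H" "Y \<in> borel_measurable H"
    using Cons.prems(1) Cons.IH[OF _ *(2)] by (simp_all add: x)
  note [measurable] = this(2,3) measurable_from_subalg[OF this(1) *(1)]
  show ?case unfolding * by measurable
qed

text \<open>The discrepancy is pushed down the list until \<open>L0_zero\<close> at its end absorbs
  it.\<close>

lemma gen_cone_AE_cong:
  assumes "chronological H l" "X \<in> gen_cone M H l" "X' \<in> borel_measurable H" "AE \<omega> in M. X \<omega> = X' \<omega>"
  shows "X' \<in> gen_cone M H l"
  using assms
proof (induction l arbitrary: X X')
  case Nil
  have "AE \<omega> in M. X' \<omega> = 0"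
    using Nil.prems(2,4) unfolding gen_cone.simps L0_zero_def by auto
  then show ?case using Nil.prems by (simp add: L0_zero_def L0_def)
next
  case (Cons x l)
  obtain G g b where x: "x = (G, g, b)" by (cases x)
  from Cons.prems(2) obtain \<alpha> Y where *: "\<alpha> \<in> borel_measurable G" "b \<or> (\<forall>\<omega>. 0 \<le> \<alpha> \<omega>)"
    "Y \<in> gen_cone M H l" "X = (\<lambda>\<omega>. \<alpha> \<omega> *\<^sub>R g \<omega> + Y \<omega>)" unfolding x by (elim gen_cone_ConsE)
  have "subalgebra H G" "g \<in> borel_measurable H" using Cons.prems(1) by (simp_all add: x)
  note [measurable] = this(2) Cons.prems(3) measurable_from_subalg[OF this(1) *(1)]
  have "(\<lambda>\<omega>. X' \<omega> - \<alpha> \<omega> *\<^sub>R g \<omega>) \<in> gen_cone M H l"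
  proof (rule Cons.IH[OF _ *(3)])
    show "AE \<omega> in M. Y \<omega> = X' \<omega> - \<alpha> \<omega> *\<^sub>R g \<omega>" using Cons.prems(4) by eventually_elim (auto simp: * algebra_simps)
  qed (use Cons.prems in \<open>auto simp: x\<close>)
  then show ?case unfolding x by (rule gen_cone_ConsI[OF *(1,2)]) auto
qed

lemma gen_cone_tail:
  assumes "X \<in> gen_cone M H l"
  shows "X \<in> gen_cone M H (x # l)"
proof (cases x)
  case (fields G g b)
  show ?thesis
    unfolding fields by (rule gen_cone_ConsI[where \<alpha> = "\<lambda>_. 0", OF _ _ assms]) auto
qed

lemma gen_cone_zero: "(\<lambda>\<omega>. 0) \<in> gen_cone M H l"
proof (induction l)
  case Nil
  then show ?case by (simp add: L0_zero_def L0_def)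
next
  case (Cons x l)
  show ?case by (rule gen_cone_tail[OF Cons])
qed

lemma gen_cone_add:
  assumes "X \<in> gen_cone M H l" "Y \<in> gen_cone M H l"
  shows "(\<lambda>\<omega>. X \<omega> + Y \<omega>) \<in> gen_cone M H l"
  using assms
proof (induction l arbitrary: X Y)
  case Nil
  then show ?case by (auto simp: L0_zero_def L0_def)
next
  case (Cons x l)
  obtain G g b where x: "x = (G, g, b)" by (cases x)
  from Cons.prems(1) obtain \<alpha> X' where X: "\<alpha> \<in> borel_measurable G" "b \<or> (\<forall>\<omega>. 0 \<le> \<alpha> \<omega>)"
    "X' \<in> gen_cone M H l" "X = (\<lambda>\<omega>. \<alpha> \<omega> *\<^sub>R g \<omega> + X' \<omega>)" unfolding x by (elim gen_cone_ConsE)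
  from Cons.prems(2) obtain \<beta> Y' where Y: "\<beta> \<in> borel_measurable G" "b \<or> (\<forall>\<omega>. 0 \<le> \<beta> \<omega>)"
    "Y' \<in> gen_cone M H l" "Y = (\<lambda>\<omega>. \<beta> \<omega> *\<^sub>R g \<omega> + Y' \<omega>)" unfolding x by (elim gen_cone_ConsE)
  show ?case unfolding x
    by (rule gen_cone_ConsI[OF _ _ Cons.IH[OF X(3) Y(3)], where \<alpha> = "\<lambda>\<omega>. \<alpha> \<omega> + \<beta> \<omega>"])
      (use X Y in \<open>auto simp: algebra_simps\<close>)
qed

lemma gen_cone_generator:
  assumes "(G, g, b) \<in> set l" "\<alpha> \<in> borel_measurable G" "b \<or> (\<forall>\<omega>. 0 \<le> \<alpha> \<omega>)"
  shows "(\<lambda>\<omega>. \<alpha> \<omega> *\<^sub>R g \<omega>) \<in> gen_cone M H l"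
  using assms(1)
proof (induction l)
  case (Cons x l)
  from Cons.prems consider "x = (G, g, b)" | "(G, g, b) \<in> set l" by auto
  then show ?case
  proof cases
    case 1
    show ?thesis unfolding 1 by (rule gen_cone_ConsI[OF assms(2,3) gen_cone_zero]) simp
  next
    case 2
    show ?thesis by (rule gen_cone_tail[OF Cons.IH[OF 2]])
  qed
qed simp

lemma gen_cone_subset:
  assumes zero: "L0_zero M H \<subseteq> C"
    and add: "\<And>X Y. X \<in> C \<Longrightarrow> Y \<in> C \<Longrightarrow> (\<lambda>\<omega>. X \<omega> + Y \<omega>) \<in> C"
    and gen: "\<And>G g b \<alpha>. (G, g, b) \<in> set l \<Longrightarrow> \<alpha> \<in> borel_measurable G \<Longrightarrow> b \<or> (\<forall>\<omega>. 0 \<le> \<alpha> \<omega>) \<Longrightarrow>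
      (\<lambda>\<omega>. \<alpha> \<omega> *\<^sub>R g \<omega>) \<in> C"
  shows "gen_cone M H l \<subseteq> C"
  using gen
proof (induction l)
  case Nil
  then show ?case using zero by simp
next
  case (Cons x l)
  obtain G g b where x: "x = (G, g, b)" by (cases x)
  have IH: "gen_cone M H l \<subseteq> C" by (intro Cons.IH) (auto intro: Cons.prems)
  show ?case
  proof
    fix X assume "X \<in> gen_cone M H (x # l)"
    then obtain \<alpha> Y where X: "\<alpha> \<in> borel_measurable G" "b \<or> (\<forall>\<omega>. 0 \<le> \<alpha> \<omega>)"
      "Y \<in> gen_cone M H l" "X = (\<lambda>\<omega>. \<alpha> \<omega> *\<^sub>R g \<omega> + Y \<omega>)" unfolding x by (elim gen_cone_ConsE)
    then show "X \<in> C" using add[OF Cons.prems[of G g b \<alpha>], of Y] IH by (auto simp: x)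
  qed
qed

section \<open>Random multipliers and random indices\<close>

lemma gen_cone_scale:
  assumes "chronological H l" "\<forall>x\<in>set l. subalgebra (fst x) G"
    "subalgebra H G" "h \<in> borel_measurable G" "\<And>\<omega>. 0 \<le> h \<omega>" "X \<in> gen_cone M H l"
  shows "(\<lambda>\<omega>. h \<omega> *\<^sub>R X \<omega>) \<in> gen_cone M H l"
  using assms(1,2,6)
proof (induction l arbitrary: X)
  case Nil
  then show ?case
    using measurable_from_subalg[OF assms(3,4)] by (auto simp: L0_zero_def L0_def)
next
  case (Cons x l)
  obtain G' g b where x: "x = (G', g, b)" by (cases x)
  from Cons.prems(3) obtain \<alpha> Y where X: "\<alpha> \<in> borel_measurable G'" "b \<or> (\<forall>\<omega>. 0 \<le> \<alpha> \<omega>)"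
    "Y \<in> gen_cone M H l" "X = (\<lambda>\<omega>. \<alpha> \<omega> *\<^sub>R g \<omega> + Y \<omega>)" unfolding x by (elim gen_cone_ConsE)
  have "subalgebra G' G" using Cons.prems(2) by (simp add: x)
  note [measurable] = X(1) measurable_from_subalg[OF this assms(4)]
  have "(\<lambda>\<omega>. h \<omega> *\<^sub>R Y \<omega>) \<in> gen_cone M H l"
    using Cons.prems by (intro Cons.IH X(3)) (auto simp: x)
  then show ?case unfolding x
    by (rule gen_cone_ConsI[where \<alpha> = "\<lambda>\<omega>. h \<omega> * \<alpha> \<omega>", rotated 2])
      (use X(2) assms(5) in \<open>auto simp: X(4) algebra_simps\<close>)
qed

text \<open>This permits a different subsequence for each \<omega>: the mixed coefficients stay
  measurable because \<tau> is known to a \<sigma>-algebra contained in each of theirs.\<close>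

lemma gen_cone_random_index:
  assumes "chronological H l" "\<forall>x\<in>set l. subalgebra (fst x) G"
    "subalgebra H G" "\<tau> \<in> measurable G (count_space (UNIV :: nat set))" "\<And>n. X n \<in> gen_cone M H l"
  shows "(\<lambda>\<omega>. X (\<tau> \<omega>) \<omega>) \<in> gen_cone M H l"
  using assms(1,2,5)
proof (induction l arbitrary: X)
  case Nil
  note \<tau> = measurable_from_subalg[OF assms(3,4)]
  have X: "X n \<in> borel_measurable H" "AE \<omega> in M. X n \<omega> = 0" for n
    using Nil.prems(3)[of n] by (simp_all add: L0_zero_def L0_def)
  have "(\<lambda>\<omega>. X (\<tau> \<omega>) \<omega>) \<in> borel_measurable H"
    by (rule measurable_compose_countable[OF X(1) \<tau>])
  \<comment> \<open>Only countably many index values occur, so their exceptional null sets are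
    discarded together.\<close>
  moreover have "AE \<omega> in M. \<forall>n. X n \<omega> = 0" using X(2) by (simp add: AE_all_countable)
  then have "AE \<omega> in M. X (\<tau> \<omega>) \<omega> = 0" by eventually_elim simp
  ultimately show ?case by (simp add: L0_zero_def L0_def)
next
  case (Cons x l)
  obtain G' g b where x: "x = (G', g, b)" by (cases x)
  from gen_cone_ConsE_seq[of X, OF Cons.prems(3)[unfolded x]] obtain \<alpha> Y where
    *: "\<forall>n. \<alpha> n \<in> borel_measurable G' \<and> (b \<or> (\<forall>\<omega>. 0 \<le> \<alpha> n \<omega>)) \<and> Y n \<in> gen_cone M H l \<and>
      X n = (\<lambda>\<omega>. \<alpha> n \<omega> *\<^sub>R g \<omega> + Y n \<omega>)" by (elim exE)
  have X: "\<alpha> n \<in> borel_measurable G'" "b \<or> (\<forall>\<omega>. 0 \<le> \<alpha> n \<omega>)" "Y n \<in> gen_cone M H l"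
    "X n = (\<lambda>\<omega>. \<alpha> n \<omega> *\<^sub>R g \<omega> + Y n \<omega>)" for n
    using *[rule_format, of n] by simp_all
  have "subalgebra G' G" using Cons.prems(2) by (simp add: x)
  from measurable_from_subalg[OF this assms(4)]
  have \<alpha>: "(\<lambda>\<omega>. \<alpha> (\<tau> \<omega>) \<omega>) \<in> borel_measurable G'"
    by (rule measurable_compose_countable[OF X(1)])
  have Y: "(\<lambda>\<omega>. Y (\<tau> \<omega>) \<omega>) \<in> gen_cone M H l"
    by (rule Cons.IH[OF _ _ X(3)]) (use Cons.prems(1,2) in \<open>simp_all add: x\<close>)
  have "b \<or> (\<forall>\<omega>. 0 \<le> \<alpha> (\<tau> \<omega>) \<omega>)" using X(2) by (cases b) simp_all
  moreover have "X (\<tau> \<omega>) \<omega> = \<alpha> (\<tau> \<omega>) \<omega> *\<^sub>R g \<omega> + Y (\<tau> \<omega>) \<omega>" for \<omega>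
    by (rule fun_cong[OF X(4)])
  ultimately show ?case unfolding x by (rule gen_cone_ConsI[OF \<alpha> _ Y])
qed

text \<open>If an element is reversible in \<open>W\<close>, so is each of its summands. Its rays
  then vanish and only lines remain, and these admit a factor \<open>h\<close> of any sign.\<close>

lemma gen_cone_reverse:
  assumes "chronological H l" "\<forall>x\<in>set l. subalgebra (fst x) G"
    and sub: "subalgebra H G" and h: "h \<in> borel_measurable G"
    and add: "\<And>X Y. X \<in> W \<Longrightarrow> Y \<in> W \<Longrightarrow> (\<lambda>\<omega>. X \<omega> + Y \<omega>) \<in> W"
    and "gen_cone M H l \<subseteq> W"
    and "\<And>G' g \<alpha>. (G', g, False) \<in> set l \<Longrightarrow> \<alpha> \<in> borel_measurable G' \<Longrightarrow> (\<And>\<omega>. 0 \<le> \<alpha> \<omega>) \<Longrightarrow>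
      (\<lambda>\<omega>. - (\<alpha> \<omega> *\<^sub>R g \<omega>)) \<in> W \<Longrightarrow> AE \<omega> in M. \<alpha> \<omega> *\<^sub>R g \<omega> = 0"
    and "X \<in> gen_cone M H l" "(\<lambda>\<omega>. - X \<omega>) \<in> W"
  shows "(\<lambda>\<omega>. h \<omega> *\<^sub>R X \<omega>) \<in> gen_cone M H l"
  using assms(1,2,6-9)
proof (induction l arbitrary: X)
  case Nil
  then show ?case
    using measurable_from_subalg[OF sub h] by (auto simp: L0_zero_def L0_def)
next
  case (Cons x l)
  obtain G' g b where x: "x = (G', g, b)" by (cases x)
  from Cons.prems(5) obtain \<alpha> Y where X: "\<alpha> \<in> borel_measurable G'" "b \<or> (\<forall>\<omega>. 0 \<le> \<alpha> \<omega>)"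
    "Y \<in> gen_cone M H l" "X = (\<lambda>\<omega>. \<alpha> \<omega> *\<^sub>R g \<omega> + Y \<omega>)" unfolding x by (elim gen_cone_ConsE)
  have "subalgebra G' G" using Cons.prems(2) by (simp add: x)
  note [measurable] = X(1) measurable_from_subalg[OF this h]
  have "(\<lambda>\<omega>. \<alpha> \<omega> *\<^sub>R g \<omega>) \<in> gen_cone M H (x # l)"
    by (rule gen_cone_generator[OF _ X(1,2)]) (simp add: x)
  then have "(\<lambda>\<omega>. \<alpha> \<omega> *\<^sub>R g \<omega>) \<in> W" "Y \<in> W"
    using gen_cone_tail[OF X(3), of x] Cons.prems(3) by blast+
  \<comment> \<open>Cancelling one summand of \<open>- X\<close> leaves the negative of the other,
    still in \<open>W\<close>.\<close>
  from add[OF Cons.prems(6) this(1)] add[OF Cons.prems(6) this(2)]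
  have mY: "(\<lambda>\<omega>. - Y \<omega>) \<in> W" and mg: "(\<lambda>\<omega>. - (\<alpha> \<omega> *\<^sub>R g \<omega>)) \<in> W"
    by (simp_all add: X(4))
  have hY: "(\<lambda>\<omega>. h \<omega> *\<^sub>R Y \<omega>) \<in> gen_cone M H l"
  proof (rule Cons.IH[OF _ _ _ _ X(3) mY])
    show "gen_cone M H l \<subseteq> W" using gen_cone_tail[of _ M H l x] Cons.prems(3) by blast
    show "AE \<omega> in M. \<alpha> \<omega> *\<^sub>R g \<omega> = 0" if "(G', g, False) \<in> set l" "\<alpha> \<in> borel_measurable G'"
      "\<And>\<omega>. 0 \<le> \<alpha> \<omega>" "(\<lambda>\<omega>. - (\<alpha> \<omega> *\<^sub>R g \<omega>)) \<in> W" for G' g \<alpha>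
      by (rule Cons.prems(4)[OF _ that(2-4)]) (simp add: that(1))
  qed (use Cons.prems(1,2) in \<open>simp_all add: x\<close>)
  show ?case
  proof (cases b)
    case True
    show ?thesis unfolding x
      by (rule gen_cone_ConsI[OF _ _ hY, where \<alpha> = "\<lambda>\<omega>. h \<omega> * \<alpha> \<omega>"])
        (auto simp: True X(4) algebra_simps)
  next
    case False
    then have "AE \<omega> in M. \<alpha> \<omega> *\<^sub>R g \<omega> = 0"
      using X(2) by (intro Cons.prems(4)[OF _ X(1) _ mg]) (auto simp: x)
    then have "AE \<omega> in M. h \<omega> *\<^sub>R Y \<omega> = h \<omega> *\<^sub>R X \<omega>"
      by eventually_elim (simp add: X(4))
    moreover have "(\<lambda>\<omega>. h \<omega> *\<^sub>R X \<omega>) \<in> borel_measurable H"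
      using measurable_from_subalg[OF sub h] gen_cone_measurable[OF Cons.prems(1,5)]
      by (intro borel_measurable_scaleR)
    ultimately show ?thesis
      by (intro gen_cone_AE_cong[OF Cons.prems(1) gen_cone_tail[OF hY]])
  qed
qed

text \<open>Where the coefficients of \<open>g\<close> are unbounded above, dividing by them along a random subsequence
  exhibits \<open>- g\<close> as a limit from the remaining cone.\<close>

lemma gen_cone_unbounded:
  fixes \<alpha> :: "nat \<Rightarrow> 'a \<Rightarrow> real"
  assumes chron: "chronological H l" "\<forall>x\<in>set l. subalgebra (fst x) G" "subalgebra H G"
    and [measurable]: "g \<in> borel_measurable H" "\<And>n. \<alpha> n \<in> borel_measurable G"
    and Y: "\<And>n. Y n \<in> gen_cone M H l"
    and closed: "ae_closed M H (gen_cone M H l)"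
    and lim: "AE \<omega> in M. (\<lambda>n. \<alpha> n \<omega> *\<^sub>R g \<omega> + Y n \<omega>) \<longlonglongrightarrow> X \<omega>"
  shows "(\<lambda>\<omega>. - ((if \<forall>N::nat. \<exists>n. real N \<le> \<alpha> n \<omega> then 1 else 0) *\<^sub>R g \<omega>)) \<in> gen_cone M H l"
proof -
  define U where "U \<omega> \<longleftrightarrow> (\<forall>N::nat. \<exists>n. real N \<le> \<alpha> n \<omega>)" for \<omega>
  have UG[measurable]: "Measurable.pred G U" unfolding U_def by measurable
  \<comment> \<open>Both the index and the coefficient are pushed to infinity: the first to reach
    the limit \<open>X\<close>, the second to make division kill it.\<close>
  define \<tau> where "\<tau> k \<omega> = (LEAST n. k \<le> n \<and> real (Suc k) \<le> \<alpha> n \<omega>)" for k \<omega>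
  have \<tau>[measurable]: "\<tau> k \<in> measurable G (count_space UNIV)" for k unfolding \<tau>_def by measurable
  have *: "k \<le> \<tau> k \<omega> \<and> real (Suc k) \<le> \<alpha> (\<tau> k \<omega>) \<omega>" if u: "U \<omega>" for k \<omega>
  proof -
    \<comment> \<open>\<open>N\<close> exceeds every coefficient up to index \<open>k\<close>, so a
      coefficient of at least \<open>N\<close> can only occur later.\<close>
    obtain N :: nat where N: "Max ((\<lambda>n. \<alpha> n \<omega>) ` {..k}) < N" using reals_Archimedean2 by blast
    obtain n where n: "real (max N (Suc k)) \<le> \<alpha> n \<omega>" using u[unfolded U_def, rule_format] by blast
    have "k \<le> n"
    proof (rule ccontr)
      assume "\<not> k \<le> n"
      then have "\<alpha> n \<omega> \<le> Max ((\<lambda>n. \<alpha> n \<omega>) ` {..k})" by (intro Max_ge) auto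
      moreover have "real N \<le> \<alpha> n \<omega>" using n by simp
      ultimately show False using N by linarith
    qed
    then have "\<exists>n. k \<le> n \<and> real (Suc k) \<le> \<alpha> n \<omega>" using n by (intro exI[of _ n]) simp
    then show ?thesis unfolding \<tau>_def by (rule LeastI_ex)
  qed
  \<comment> \<open>On \<open>U\<close> the coefficient is at least 1 and \<open>max 1\<close>
    changes nothing; it makes nonnegativity of \<open>h\<close>, needed for scaling a cone,
    immediate.\<close>
  define h where "h k \<omega> = (if U \<omega> then inverse (max 1 (\<alpha> (\<tau> k \<omega>) \<omega>)) else 0)" for k \<omega>
  have "(\<lambda>\<omega>. \<alpha> (\<tau> k \<omega>) \<omega>) \<in> borel_measurable G" for k
    by (rule measurable_compose_countable) measurable
  then have h: "h k \<in> borel_measurable G" for k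
    unfolding h_def by measurable
  have "(\<lambda>\<omega>. h k \<omega> *\<^sub>R Y (\<tau> k \<omega>) \<omega>) \<in> gen_cone M H l" for k
    by (intro gen_cone_scale[OF chron h] gen_cone_random_index[OF chron \<tau> Y]) (auto simp: h_def)
  moreover have "(\<lambda>\<omega>. - ((if U \<omega> then 1 else 0) *\<^sub>R g \<omega>)) \<in> borel_measurable H"
  proof -
    have "(\<lambda>\<omega>. if U \<omega> then 1 else 0 :: real) \<in> borel_measurable G" by measurable
    note [measurable] = measurable_from_subalg[OF chron(3) this]
    show ?thesis by measurable
  qed
  moreover have "AE \<omega> in M. (\<lambda>k. h k \<omega> *\<^sub>R Y (\<tau> k \<omega>) \<omega>) \<longlonglongrightarrow> - ((if U \<omega> then 1 else 0) *\<^sub>R g \<omega>)"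
    using lim
  proof eventually_elim
    case (elim \<omega>)
    show ?case
    proof (cases "U \<omega>")
      case True
      note * = *[OF True]
      let ?a = "\<lambda>k. \<alpha> (\<tau> k \<omega>) \<omega>"
      have "max 1 (?a k) = ?a k" "?a k \<noteq> 0" for k
        using *[of k] by auto
      \<comment> \<open>The bracket converges to \<open>X \<omega>\<close> and its factor tends to
        0, so only \<open>- g \<omega>\<close> survives.\<close>
      then have eq: "h k \<omega> *\<^sub>R Y (\<tau> k \<omega>) \<omega> = inverse (?a k) *\<^sub>R (?a k *\<^sub>R g \<omega> + Y (\<tau> k \<omega>) \<omega>) - g \<omega>" for k
        using True by (simp add: h_def algebra_simps)
      have "filterlim ?a at_top sequentially"
        by (rule filterlim_at_top_mono[OF filterlim_compose[OF filterlim_real_sequentially filterlim_Suc]])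
          (use * in auto)
      then have "(\<lambda>k. inverse (?a k)) \<longlonglongrightarrow> 0" by (rule tendsto_inverse_0_at_top)
      moreover have "(\<lambda>k. ?a k *\<^sub>R g \<omega> + Y (\<tau> k \<omega>) \<omega>) \<longlonglongrightarrow> X \<omega>"
        by (rule filterlim_random_subsequence[OF _ elim]) (use * in blast)
      ultimately have "(\<lambda>k. h k \<omega> *\<^sub>R Y (\<tau> k \<omega>) \<omega>) \<longlonglongrightarrow> 0 *\<^sub>R X \<omega> - g \<omega>"
        unfolding eq by (intro tendsto_intros)
      then show ?thesis using True by simp
    qed (simp add: h_def)
  qed
  ultimately show ?thesis unfolding U_def[symmetric] L0_def[symmetric] by (rule ae_closedD[OF closed])
qed

text \<open>Rays are tested in a fixed additive set \<open>W\<close> rather than in the cone itself: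
  the hypotheses then pass unchanged to the tail of the list, as the induction requires.\<close>

lemma ae_closed_gen_cone:
  assumes "chronological H l"
    and add: "\<And>X Y. X \<in> W \<Longrightarrow> Y \<in> W \<Longrightarrow> (\<lambda>\<omega>. X \<omega> + Y \<omega>) \<in> W"
    and "gen_cone M H l \<subseteq> W"
    and "\<And>G g \<alpha>. (G, g, False) \<in> set l \<Longrightarrow> \<alpha> \<in> borel_measurable G \<Longrightarrow> (\<And>\<omega>. 0 \<le> \<alpha> \<omega>) \<Longrightarrow>
      (\<lambda>\<omega>. - (\<alpha> \<omega> *\<^sub>R g \<omega>)) \<in> W \<Longrightarrow> AE \<omega> in M. \<alpha> \<omega> *\<^sub>R g \<omega> = 0"
  shows "ae_closed M H (gen_cone M H l)"
  using assms(1,3,4)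
proof (induction l)
  case Nil
  show ?case
    unfolding ae_closed_def
  proof (intro allI impI)
    fix Xs and X :: "'a \<Rightarrow> real ^ 'b"
    assume Xs: "\<forall>n. Xs n \<in> gen_cone M H []" and X: "X \<in> L0 H"
      and lim: "AE \<omega> in M. (\<lambda>n. Xs n \<omega>) \<longlonglongrightarrow> X \<omega>"
    have "AE \<omega> in M. \<forall>n. Xs n \<omega> = 0" using Xs by (auto simp: AE_all_countable L0_zero_def)
    with lim have "AE \<omega> in M. X \<omega> = 0"
      by eventually_elim (auto intro: LIMSEQ_unique)
    then show "X \<in> gen_cone M H []" using X by (simp add: L0_zero_def)
  qed
next
  case (Cons x l)
  obtain G g b where x: "x = (G, g, b)" by (cases x)
  have chron: "chronological H l" "\<forall>x\<in>set l. subalgebra (fst x) G" "subalgebra H G"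
    and g[measurable]: "g \<in> borel_measurable H"
    using Cons.prems(1) by (auto simp: x)
  have lW: "gen_cone M H l \<subseteq> W" using gen_cone_tail[of _ M H l x] Cons.prems(2) by blast
  have null: "AE \<omega> in M. \<alpha> \<omega> *\<^sub>R g \<omega> = 0" if "(G', g, False) \<in> set l" "\<alpha> \<in> borel_measurable G'"
      "\<And>\<omega>. 0 \<le> \<alpha> \<omega>" "(\<lambda>\<omega>. - (\<alpha> \<omega> *\<^sub>R g \<omega>)) \<in> W" for G' g \<alpha>
    by (rule Cons.prems(3)[OF _ that(2-4)]) (simp add: that(1))
  have closed: "ae_closed M H (gen_cone M H l)"
    by (rule Cons.IH[OF chron(1) lW null])
  \<comment> \<open>Arbitrary signed multiples of tail elements become available once they are
    reversible in \<open>W\<close>; this is how a line is absorbed.\<close>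
  have reverse: "(\<lambda>\<omega>. h \<omega> *\<^sub>R X \<omega>) \<in> gen_cone M H l"
    if "h \<in> borel_measurable G" "X \<in> gen_cone M H l" "(\<lambda>\<omega>. - X \<omega>) \<in> W" for h X
    by (rule gen_cone_reverse[OF chron that(1) add lW null that(2,3)])
  show ?case
    unfolding ae_closed_def
  proof (intro allI impI)
    fix Xs X
    assume Xs: "\<forall>n. Xs n \<in> gen_cone M H (x # l)" and "X \<in> L0 H"
      and lim: "AE \<omega> in M. (\<lambda>n. Xs n \<omega>) \<longlonglongrightarrow> X \<omega>"
    then have [measurable]: "X \<in> borel_measurable H" by (simp add: L0_def)
    from gen_cone_ConsE_seq[of Xs, OF Xs[rule_format, unfolded x]] obtain \<alpha> Y where
      *: "\<forall>n. \<alpha> n \<in> borel_measurable G \<and> (b \<or> (\<forall>\<omega>. 0 \<le> \<alpha> n \<omega>)) \<and> Y n \<in> gen_cone M H l \<and>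
        Xs n = (\<lambda>\<omega>. \<alpha> n \<omega> *\<^sub>R g \<omega> + Y n \<omega>)" by (elim exE)
    have \<alpha>[measurable]: "\<alpha> n \<in> borel_measurable G" and b: "b \<or> (\<forall>\<omega>. 0 \<le> \<alpha> n \<omega>)"
      and Y: "Y n \<in> gen_cone M H l" and eq: "Xs n = (\<lambda>\<omega>. \<alpha> n \<omega> *\<^sub>R g \<omega> + Y n \<omega>)" for n
      using *[rule_format, of n] by simp_all
    have lim': "AE \<omega> in M. (\<lambda>n. \<alpha> n \<omega> *\<^sub>R g \<omega> + Y n \<omega>) \<longlonglongrightarrow> X \<omega>"
      using lim unfolding eq .
    have gen: "(\<lambda>\<omega>. \<beta> \<omega> *\<^sub>R g \<omega>) \<in> W" if "\<beta> \<in> borel_measurable G" "b \<or> (\<forall>\<omega>. 0 \<le> \<beta> \<omega>)" for \<beta>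
      using gen_cone_generator[of G g b "x # l", OF _ that] Cons.prems(2) by (auto simp: x)
    \<comment> \<open>The sample space is split by whether the coefficients are unbounded above
      (\<open>U\<close>), unbounded below (\<open>V\<close>) or bounded. On the first two regions
      the head term is moved into the tail.\<close>
    define U where "U \<omega> \<longleftrightarrow> (\<forall>N::nat. \<exists>n. real N \<le> \<alpha> n \<omega>)" for \<omega>
    define V where "V \<omega> \<longleftrightarrow> (\<forall>N::nat. \<exists>n. real N \<le> - \<alpha> n \<omega>)" for \<omega>
    have [measurable]: "Measurable.pred G U" "Measurable.pred G V" unfolding U_def V_def by measurable
    have U: "(\<lambda>\<omega>. (if U \<omega> then \<alpha> n \<omega> else 0) *\<^sub>R g \<omega>) \<in> gen_cone M H l" for n
    proof -
      have *: "(\<lambda>\<omega>. - ((if U \<omega> then 1 else 0) *\<^sub>R g \<omega>)) \<in> gen_cone M H l"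
        unfolding U_def
        by (rule gen_cone_unbounded[where Y = Y and X = X, OF chron g \<alpha> Y closed]) (rule lim')
      show ?thesis
      proof (cases b)
        case True
        \<comment> \<open>The tail contains \<open>- g\<close> on \<open>U\<close>, and it is
          reversible in \<open>W\<close> because \<open>g\<close> is a line. The signed factor
          \<open>- \<alpha> n\<close> therefore recovers the whole head term.\<close>
        have "(\<lambda>\<omega>. (- \<alpha> n \<omega>) *\<^sub>R (- ((if U \<omega> then 1 else 0) *\<^sub>R g \<omega>))) \<in> gen_cone M H l"
        proof (rule reverse[OF _ *])
          show "(\<lambda>\<omega>. - (- ((if U \<omega> then 1 else 0) *\<^sub>R g \<omega>))) \<in> W"
            unfolding minus_minus by (rule gen) auto
        qed measurable
        then show ?thesis by (rule back_subst[of "\<lambda>X. X \<in> gen_cone M H l"]) (auto simp: fun_eq_iff)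
      next
        case False
        \<comment> \<open>For a ray, membership of \<open>- g\<close> on \<open>U\<close> in the
          tail, hence in \<open>W\<close>, forces \<open>g\<close> to vanish there.\<close>
        have "AE \<omega> in M. (if U \<omega> then 1 else 0) *\<^sub>R g \<omega> = 0"
          using * lW False by (intro Cons.prems(3)) (auto simp: x)
        then have "AE \<omega> in M. 0 = (if U \<omega> then \<alpha> n \<omega> else 0) *\<^sub>R g \<omega>"
          by eventually_elim (auto split: if_splits)
        moreover have "(\<lambda>\<omega>. (if U \<omega> then \<alpha> n \<omega> else 0) *\<^sub>R g \<omega>) \<in> borel_measurable H"
          by (rule borel_measurable_scaleR[OF measurable_from_subalg[OF chron(3)]]) measurable
        ultimately show ?thesis by (intro gen_cone_AE_cong[OF chron(1) gen_cone_zero])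
      qed
    qed
    \<comment> \<open>\<open>U\<close> is excluded so that the overlap is not moved twice.\<close>
    have V: "(\<lambda>\<omega>. (if V \<omega> \<and> \<not> U \<omega> then \<alpha> n \<omega> else 0) *\<^sub>R g \<omega>) \<in> gen_cone M H l" for n
    proof (cases b)
      case True
      \<comment> \<open>Changing the sign of both the coefficients and \<open>g\<close> leaves the
        products alone and turns unboundedness below into unboundedness above.\<close>
      have *: "(\<lambda>\<omega>. - ((if V \<omega> then 1 else 0) *\<^sub>R (- g \<omega>))) \<in> gen_cone M H l"
        unfolding V_def
        by (rule gen_cone_unbounded[where Y = Y and X = X, OF chron _ _ Y closed])
          (simp_all add: lim')
      have "(\<lambda>\<omega>. (if U \<omega> then 0 else \<alpha> n \<omega>) *\<^sub>R (- ((if V \<omega> then 1 else 0) *\<^sub>R (- g \<omega>)))) \<in> gen_cone M H l"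
      proof (rule reverse[OF _ *])
        have "(\<lambda>\<omega>. (if V \<omega> then - 1 else 0) *\<^sub>R g \<omega>) \<in> W"
          using True by (intro gen) auto
        then show "(\<lambda>\<omega>. - (- ((if V \<omega> then 1 else 0) *\<^sub>R (- g \<omega>)))) \<in> W"
          by (rule back_subst[of "\<lambda>X. X \<in> W"]) (auto simp: fun_eq_iff)
      qed measurable
      then show ?thesis by (rule back_subst[of "\<lambda>X. X \<in> gen_cone M H l"]) (auto simp: fun_eq_iff)
    next
      case False
      have "\<not> V \<omega>" for \<omega>
      proof
        assume "V \<omega>"
        then obtain n where "real 1 \<le> - \<alpha> n \<omega>" unfolding V_def by blast
        moreover have "0 \<le> \<alpha> n \<omega>" using b[of n] False by simp
        ultimately show False by simp
      qed
      then show ?thesis using gen_cone_zero by simp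
    qed
    \<comment> \<open>The part of the head coefficient that is not moved into the tail; it is
      bounded in \<open>n\<close> for each \<omega>.\<close>
    define \<beta> where "\<beta> n \<omega> = (if U \<omega> \<or> V \<omega> then 0 else \<alpha> n \<omega>)" for n \<omega>
    define Z where "Z n \<omega> = Xs n \<omega> - \<beta> n \<omega> *\<^sub>R g \<omega>" for n \<omega>
    have Z: "Z n \<in> gen_cone M H l" for n
      using gen_cone_add[OF gen_cone_add[OF Y U] V, of n n n]
      by (rule back_subst[of "\<lambda>X. X \<in> gen_cone M H l"]) (auto simp: fun_eq_iff Z_def eq \<beta>_def)
    have bdd: "bounded (range (\<lambda>n. \<beta> n \<omega>))" for \<omega>
    proof (cases "U \<omega> \<or> V \<omega>")
      case False
      then obtain N N' :: nat where N: "\<forall>n. \<not> real N \<le> \<alpha> n \<omega>" "\<forall>n. \<not> real N' \<le> - \<alpha> n \<omega>"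
        unfolding U_def V_def by blast
      have "norm (\<beta> n \<omega>) \<le> real N + real N'" for n
        using N(1)[rule_format, of n] N(2)[rule_format, of n] False by (auto simp: \<beta>_def abs_le_iff)
      then show ?thesis unfolding bounded_iff by auto
    qed (simp add: \<beta>_def)
    have "\<beta> n \<in> borel_measurable G" for n unfolding \<beta>_def by measurable
    from this bdd
    obtain \<tau> L where \<tau>: "\<And>k. \<tau> k \<in> measurable G (count_space (UNIV :: nat set))"
      and L: "L \<in> borel_measurable G" and le: "\<And>k \<omega>. k \<le> \<tau> k \<omega>"
      and lim\<beta>: "\<And>\<omega>. (\<lambda>k. \<beta> (\<tau> k \<omega>) \<omega>) \<longlonglongrightarrow> L \<omega>"
      by (rule bounded_random_subsequence) (rule that)
    have "(\<forall>\<omega>. 0 \<le> L \<omega>) \<or> b"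
    proof (rule disjCI)
      assume "\<not> b"
      then have "0 \<le> \<beta> n \<omega>" for n \<omega> using b[of n] by (simp add: \<beta>_def)
      then show "\<forall>\<omega>. 0 \<le> L \<omega>" using LIMSEQ_le_const[OF lim\<beta>] by blast
    qed
    \<comment> \<open>Along \<tau> the head terms converge to \<open>L\<close> times
      \<open>g\<close>, so the tail elements converge as well and closedness of the tail
      applies.\<close>
    moreover have "(\<lambda>\<omega>. X \<omega> - L \<omega> *\<^sub>R g \<omega>) \<in> gen_cone M H l"
    proof (rule ae_closedD[OF closed])
      show "(\<lambda>\<omega>. Z (\<tau> k \<omega>) \<omega>) \<in> gen_cone M H l" for k
        by (rule gen_cone_random_index[OF chron \<tau> Z])
      show "(\<lambda>\<omega>. X \<omega> - L \<omega> *\<^sub>R g \<omega>) \<in> L0 H"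
        using measurable_from_subalg[OF chron(3) L] unfolding L0_def by measurable
      show "AE \<omega> in M. (\<lambda>k. Z (\<tau> k \<omega>) \<omega>) \<longlonglongrightarrow> X \<omega> - L \<omega> *\<^sub>R g \<omega>"
        using lim
      proof eventually_elim
        case (elim \<omega>)
        show ?case unfolding Z_def
          by (intro tendsto_intros lim\<beta> filterlim_random_subsequence[OF le elim])
      qed
    qed
    ultimately show "X \<in> gen_cone M H (x # l)"
      unfolding x by (intro gen_cone_ConsI[OF L, rotated]) auto
  qed
qed


section \<open>Elementary trades\<close>

text \<open>The generators of \<open>- K(P)\<close>.\<close>

definition elementary_trade :: "real ^ 'n ^ 'n \<Rightarrow> 'n + 'n \<times> 'n \<Rightarrow> real ^ 'n" where
  "elementary_trade P k =
     (case k of Inl i \<Rightarrow> - axis i 1 | Inr (i, j) \<Rightarrow> axis j 1 - P $ i $ j *\<^sub>R axis i 1)"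

lemma elementary_trade_simps:
  "elementary_trade P (Inl i) = - axis i 1"
  "elementary_trade P (Inr (i, j)) = axis j 1 - P $ i $ j *\<^sub>R axis i 1"
  by (simp_all add: elementary_trade_def)

lemma uminus_elementary_trade_in_solvency_cone: "- elementary_trade P k \<in> solvency_cone P"
  unfolding solvency_cone_def
  by (rule hull_inc) (auto simp: elementary_trade_def split: sum.split)

text \<open>Nonnegative combinations of the finitely many generators already form a convex cone, so
  minimality of the hull gives one coefficient per generator.\<close>

lemma solvency_cone_coefficients:
  assumes "x \<in> solvency_cone P"
  shows "\<exists>c. (\<forall>k. 0 \<le> c k) \<and> - x = (\<Sum>k\<in>UNIV. c k *\<^sub>R elementary_trade P k)"
proof -
  let ?S = "{x. \<exists>c. (\<forall>k. 0 \<le> c k) \<and> - x = (\<Sum>k\<in>UNIV. c k *\<^sub>R elementary_trade P k)}"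
  have cone: "convex_cone ?S"
    unfolding convex_cone_iff
  proof (intro conjI ballI allI impI)
    show "0 \<in> ?S" by (auto intro: exI[of _ "\<lambda>_. 0"])
    show "x + y \<in> ?S" if "x \<in> ?S" "y \<in> ?S" for x y
    proof -
      from that obtain c d where
        "\<forall>k. 0 \<le> c k" "- x = (\<Sum>k\<in>UNIV. c k *\<^sub>R elementary_trade P k)"
        "\<forall>k. 0 \<le> d k" "- y = (\<Sum>k\<in>UNIV. d k *\<^sub>R elementary_trade P k)" by auto
      then have "- (x + y) = (\<Sum>k\<in>UNIV. (c k + d k) *\<^sub>R elementary_trade P k)" "\<forall>k. 0 \<le> c k + d k"
        by (simp_all add: scaleR_add_left sum.distrib)
      then show ?thesis by (intro CollectI exI[of _ "\<lambda>k. c k + d k"] conjI)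
    qed
    show "r *\<^sub>R x \<in> ?S" if "x \<in> ?S" "0 \<le> r" for x r
    proof -
      from that obtain c where
        c: "\<forall>k. 0 \<le> c k" "- x = (\<Sum>k\<in>UNIV. c k *\<^sub>R elementary_trade P k)" by auto
      have "- (r *\<^sub>R x) = r *\<^sub>R (- x)" by simp
      also have "\<dots> = (\<Sum>k\<in>UNIV. (r * c k) *\<^sub>R elementary_trade P k)"
        unfolding c(2) by (simp add: scaleR_sum_right)
      finally show ?thesis
        using c(1) that(2) by (intro CollectI exI[of _ "\<lambda>k. r * c k"] conjI) simp_all
    qed
  qed
  have gen: "- elementary_trade P k \<in> ?S" for k
    by (auto intro!: exI[of _ "\<lambda>l. if l = k then 1 else 0"] simp: if_distrib[of "\<lambda>c. c *\<^sub>R _"] cong: if_cong)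
  have "axis i 1 \<in> ?S" for i
    by (rule gen[of "Inl i", unfolded elementary_trade_simps minus_minus])
  moreover have "P $ i $ j *\<^sub>R axis i 1 - axis j 1 \<in> ?S" for i j
    by (rule gen[of "Inr (i, j)", unfolded elementary_trade_simps minus_diff_eq])
  ultimately have "range (\<lambda>i. axis i 1) \<union> {P $ i $ j *\<^sub>R axis i 1 - axis j 1 |i j. True} \<subseteq> ?S"
    by blast
  then have "solvency_cone P \<subseteq> ?S"
    unfolding solvency_cone_def by (rule hull_minimal) (rule cone)
  then show ?thesis using assms by blast
qed

text \<open>The pathwise coefficients carry no measurability. Rational coefficient vectors are
  countable, and the first one in an enumeration with error below \<open>e\<close> depends
  measurably on \<omega>.\<close>

lemma approximate_measurable_coefficients:
  fixes g :: "'k::finite \<Rightarrow> 'a \<Rightarrow> real ^ 'n"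
  assumes [measurable]: "X \<in> borel_measurable G" "\<And>k. g k \<in> borel_measurable G"
    and ae: "AE \<omega> in M. \<exists>c. (\<forall>k. 0 \<le> c k) \<and> X \<omega> = (\<Sum>k\<in>UNIV. c k *\<^sub>R g k \<omega>)" and e: "0 < e"
  shows "\<exists>c. (\<forall>k. c k \<in> borel_measurable G \<and> (\<forall>\<omega>. 0 \<le> c k \<omega>)) \<and>
    (AE \<omega> in M. dist (\<Sum>k\<in>UNIV. c k \<omega> *\<^sub>R g k \<omega>) (X \<omega>) < e)"
proof -
  \<comment> \<open>The absolute value makes every enumerated vector admissible, also on the null
    set where no good approximation need exist.\<close>
  define q where "q m k = \<bar>real_of_rat ((from_nat m :: 'k \<Rightarrow> rat) k)\<bar>" for m k
  define P where "P \<omega> m \<longleftrightarrow> dist (\<Sum>k\<in>UNIV. q m k *\<^sub>R g k \<omega>) (X \<omega>) < e" for \<omega> m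
  define \<tau> where "\<tau> \<omega> = (LEAST m. P \<omega> m)" for \<omega>
  have \<tau>[measurable]: "\<tau> \<in> measurable G (count_space UNIV)" unfolding \<tau>_def P_def by measurable
  have "(\<lambda>\<omega>. q (\<tau> \<omega>) k) \<in> borel_measurable G" for k
    by (rule measurable_compose_countable[OF _ \<tau>]) simp
  moreover have "AE \<omega> in M. P \<omega> (\<tau> \<omega>)"
    using ae
  proof eventually_elim
    case (elim \<omega>)
    then obtain c where c: "\<And>k. 0 \<le> c k" "X \<omega> = (\<Sum>k\<in>UNIV. c k *\<^sub>R g k \<omega>)" by blast
    define s where "s = (\<Sum>k\<in>UNIV. norm (g k \<omega>))"
    have s: "0 \<le> s" unfolding s_def by (intro sum_nonneg) simp
    \<comment> \<open>The total error is at most \<open>\<delta> * s\<close>; the added 1 guards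
      against all generators vanishing.\<close>
    define \<delta> where "\<delta> = e / (s + 1)"
    have \<delta>: "0 < \<delta>" "\<delta> * s < e" using s e by (auto simp: \<delta>_def field_simps)
    \<comment> \<open>Approximating from above keeps the rationals nonnegative, so the absolute
      value in \<open>q\<close> leaves them unchanged.\<close>
    have "\<exists>r. c k < real_of_rat r \<and> real_of_rat r < c k + \<delta>" for k
      by (rule of_rat_dense) (use \<delta> in simp)
    from choice[OF allI[OF this]] obtain r :: "'k \<Rightarrow> rat"
      where r: "\<forall>k. c k < real_of_rat (r k) \<and> real_of_rat (r k) < c k + \<delta>" ..
    have q: "q (to_nat r) k = real_of_rat (r k)" for k
    proof -
      have "0 \<le> real_of_rat (r k)" using r[rule_format, of k] c(1)[of k] by linarith
      then show ?thesis unfolding q_def by (simp only: from_nat_to_nat abs_of_nonneg)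
    qed
    have "dist (\<Sum>k\<in>UNIV. q (to_nat r) k *\<^sub>R g k \<omega>) (X \<omega>)
        = norm (\<Sum>k\<in>UNIV. (real_of_rat (r k) - c k) *\<^sub>R g k \<omega>)"
      by (simp add: q c(2) dist_norm scaleR_diff_left sum_subtractf)
    also have "\<dots> \<le> (\<Sum>k\<in>UNIV. \<delta> * norm (g k \<omega>))"
    proof (rule sum_norm_le)
      show "norm ((real_of_rat (r k) - c k) *\<^sub>R g k \<omega>) \<le> \<delta> * norm (g k \<omega>)" for k
        using r[rule_format, of k] by (auto intro!: mult_right_mono)
    qed
    also have "\<dots> < e" using \<delta>(2) by (simp add: s_def sum_distrib_left)
    finally have "P \<omega> (to_nat r)" unfolding P_def .
    then show ?case unfolding \<tau>_def by (rule LeastI)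
  qed
  ultimately show ?thesis
    unfolding P_def by (intro exI[of _ "\<lambda>k \<omega>. q (\<tau> \<omega>) k"]) (simp add: q_def)
qed

lemma sum_in_additive:
  assumes "finite I" "(\<lambda>\<omega>. 0) \<in> C" "\<And>X Y. X \<in> C \<Longrightarrow> Y \<in> C \<Longrightarrow> (\<lambda>\<omega>. X \<omega> + Y \<omega>) \<in> C"
    and "\<And>i. i \<in> I \<Longrightarrow> f i \<in> C"
  shows "(\<lambda>\<omega>. \<Sum>i\<in>I. f i \<omega>) \<in> C"
  using assms(1,4) by (induction I rule: finite_induct) (simp_all add: assms(2,3))

text \<open>Rational approximation of the coefficients replaces a measurable selection of them.\<close>

lemma attainable_subset_ae_closed:
  fixes P :: "nat \<Rightarrow> 'a \<Rightarrow> real ^ 'n ^ 'n"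
  assumes filt: "filtration_upto M F T"
    and P: "\<And>t k. t \<le> T \<Longrightarrow> (\<lambda>\<omega>. elementary_trade (P t \<omega>) k) \<in> borel_measurable (F t)"
    and closed: "ae_closed M (F T) C"
    and C: "(\<lambda>\<omega>. 0) \<in> C" "\<And>X Y. X \<in> C \<Longrightarrow> Y \<in> C \<Longrightarrow> (\<lambda>\<omega>. X \<omega> + Y \<omega>) \<in> C"
    and gen: "\<And>t k \<alpha>. t \<le> T \<Longrightarrow> \<alpha> \<in> borel_measurable (F t) \<Longrightarrow> (\<And>\<omega>. 0 \<le> \<alpha> \<omega>) \<Longrightarrow>
      (\<lambda>\<omega>. \<alpha> \<omega> *\<^sub>R elementary_trade (P t \<omega>) k) \<in> C"
  shows "attainable M F T P \<subseteq> C"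
proof
  fix X assume X: "X \<in> attainable M F T P"
  then obtain \<xi> where \<xi>: "\<And>t. t \<le> T \<Longrightarrow> \<xi> t \<in> trading_cone M F P t" "X = (\<lambda>\<omega>. \<Sum>t\<le>T. \<xi> t \<omega>)"
    by (auto simp: attainable_def)
  have "\<exists>Y\<in>C. AE \<omega> in M. dist (Y \<omega>) (\<xi> t \<omega>) < 1 / Suc n" if t: "t \<le> T" for t n
  proof -
    have "\<xi> t \<in> borel_measurable (F t)" "AE \<omega> in M. \<xi> t \<omega> \<in> uminus ` solvency_cone (P t \<omega>)"
      using \<xi>(1)[OF t] by (auto simp: trading_cone_def L0_in_def L0_def)
    from this(2) have ae: "AE \<omega> in M. \<exists>c. (\<forall>k. 0 \<le> c k) \<and>
        \<xi> t \<omega> = (\<Sum>k\<in>UNIV. c k *\<^sub>R elementary_trade (P t \<omega>) k)"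
    proof eventually_elim
      case (elim \<omega>)
      then obtain x where "x \<in> solvency_cone (P t \<omega>)" "\<xi> t \<omega> = - x" by blast
      then show ?case using solvency_cone_coefficients by simp
    qed
    have "\<exists>c. (\<forall>k. c k \<in> borel_measurable (F t) \<and> (\<forall>\<omega>. 0 \<le> c k \<omega>)) \<and>
        (AE \<omega> in M. dist (\<Sum>k\<in>UNIV. c k \<omega> *\<^sub>R elementary_trade (P t \<omega>) k) (\<xi> t \<omega>) < 1 / Suc n)"
      by (rule approximate_measurable_coefficients[OF \<open>\<xi> t \<in> borel_measurable (F t)\<close> P[OF t] ae]) simp
    then obtain c where c: "\<And>k. c k \<in> borel_measurable (F t)" "\<And>k \<omega>. 0 \<le> c k \<omega>"
      "AE \<omega> in M. dist (\<Sum>k\<in>UNIV. c k \<omega> *\<^sub>R elementary_trade (P t \<omega>) k) (\<xi> t \<omega>) < 1 / Suc n" by blast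
    have Y: "(\<lambda>\<omega>. \<Sum>k\<in>UNIV. c k \<omega> *\<^sub>R elementary_trade (P t \<omega>) k) \<in> C"
      by (intro sum_in_additive C gen t c(1,2)) simp
    show ?thesis
      by (rule bexI[of "\<lambda>Y. AE \<omega> in M. dist (Y \<omega>) (\<xi> t \<omega>) < 1 / Suc n", OF c(3) Y])
  qed
  then have "\<forall>p. \<exists>Y. fst p \<le> T \<longrightarrow> Y \<in> C \<and> (AE \<omega> in M. dist (Y \<omega>) (\<xi> (fst p) \<omega>) < 1 / Suc (snd p))"
    by blast
  from choice[OF this] obtain f where f: "\<forall>p. fst p \<le> T \<longrightarrow>
      f p \<in> C \<and> (AE \<omega> in M. dist (f p \<omega>) (\<xi> (fst p) \<omega>) < 1 / Suc (snd p))" ..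
  define Y where "Y t n = f (t, n)" for t n
  have Y: "Y t n \<in> C" "AE \<omega> in M. dist (Y t n \<omega>) (\<xi> t \<omega>) < 1 / Suc n" if "t \<le> T" for t n
    using f[rule_format, of "(t, n)"] that by (simp_all add: Y_def)
  have lim: "AE \<omega> in M. (\<lambda>n. Y t n \<omega>) \<longlonglongrightarrow> \<xi> t \<omega>" if t: "t \<le> T" for t
  proof -
    have "AE \<omega> in M. \<forall>n. dist (Y t n \<omega>) (\<xi> t \<omega>) < 1 / Suc n" using Y(2)[OF t] by (simp add: AE_all_countable)
    then show ?thesis
    proof eventually_elim
      case (elim \<omega>)
      show ?case
      proof (subst tendsto_dist_iff, rule tendsto_sandwich[of "\<lambda>_. 0" _ _ "\<lambda>n. 1 / Suc n"])
        show "(\<lambda>n. 1 / real (Suc n)) \<longlonglongrightarrow> 0" by (rule LIMSEQ_Suc[OF lim_1_over_n])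
      qed (use elim in \<open>auto intro!: always_eventually less_imp_le\<close>)
    qed
  qed
  show "X \<in> C"
  proof (rule ae_closedD[OF closed])
    show "(\<lambda>\<omega>. \<Sum>t\<le>T. Y t n \<omega>) \<in> C" for n
      by (intro sum_in_additive C Y(1)) auto
    show "X \<in> L0 (F T)" using attainable_subset_L0[OF filt] X by blast
    have "AE \<omega> in M. \<forall>t\<in>{..T}. (\<lambda>n. Y t n \<omega>) \<longlonglongrightarrow> \<xi> t \<omega>"
      using lim by (intro AE_finite_allI) auto
    then show "AE \<omega> in M. (\<lambda>n. \<Sum>t\<le>T. Y t n \<omega>) \<longlonglongrightarrow> X \<omega>"
      unfolding \<xi>(2) by eventually_elim (intro tendsto_sum, blast)
  qed
qed

section \<open>Almost sure modifications and scaled trades\<close>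

lemma ae_closed_AE_cong:
  assumes "ae_closed M G S" "X \<in> S" "X' \<in> L0 G" "AE \<omega> in M. X \<omega> = X' \<omega>"
  shows "X' \<in> S"
proof (rule ae_closedD[OF assms(1) _ assms(3)])
  show "AE \<omega> in M. (\<lambda>n::nat. X \<omega>) \<longlonglongrightarrow> X' \<omega>" using assms(4) by eventually_elim simp
qed (rule assms(2))

lemma scaled_trade_attainable:
  assumes t: "t \<le> T" and [measurable]: "\<alpha> \<in> borel_measurable (F t)"
    "(\<lambda>\<omega>. elementary_trade (Q t \<omega>) k) \<in> borel_measurable (F t)"
    and nonneg: "AE \<omega> in M. 0 \<le> \<alpha> \<omega>"
  shows "(\<lambda>\<omega>. \<alpha> \<omega> *\<^sub>R elementary_trade (Q t \<omega>) k) \<in> attainable M F T Q"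
proof (rule trading_cone_subset_attainable[OF t])
  have "AE \<omega> in M. \<alpha> \<omega> *\<^sub>R elementary_trade (Q t \<omega>) k \<in> uminus ` solvency_cone (Q t \<omega>)"
    using nonneg
  proof eventually_elim
    case (elim \<omega>)
    have "\<alpha> \<omega> *\<^sub>R (- elementary_trade (Q t \<omega>) k) \<in> solvency_cone (Q t \<omega>)"
      using elim uminus_elementary_trade_in_solvency_cone
      by (rule convex_cone_scaleR[OF convex_cone_solvency_cone])
    then show ?case by (rule rev_image_eqI) simp
  qed
  moreover have "(\<lambda>\<omega>. \<alpha> \<omega> *\<^sub>R elementary_trade (Q t \<omega>) k) \<in> borel_measurable (F t)" by measurable
  ultimately show "(\<lambda>\<omega>. \<alpha> \<omega> *\<^sub>R elementary_trade (Q t \<omega>) k) \<in> trading_cone M F Q t"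
    by (simp add: trading_cone_def L0_in_def L0_def)
qed

text \<open>The a.s. null difference is itself a trade at time \<open>T\<close>, since 0 lies in the
  solvency cone.\<close>

lemma attainable_AE_cong:
  assumes "X \<in> attainable M F T Q" "X \<in> L0 (F T)" "X' \<in> L0 (F T)" "AE \<omega> in M. X \<omega> = X' \<omega>"
  shows "X' \<in> attainable M F T Q"
proof -
  have "AE \<omega> in M. X' \<omega> - X \<omega> \<in> uminus ` solvency_cone (Q T \<omega>)"
    using assms(4)
  proof eventually_elim
    case (elim \<omega>)
    have "0 \<in> solvency_cone (Q T \<omega>)" by (rule convex_cone_contains_0[OF convex_cone_solvency_cone])
    then show ?case by (rule rev_image_eqI) (simp add: elim)
  qed
  then have "(\<lambda>\<omega>. X' \<omega> - X \<omega>) \<in> attainable M F T Q"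
    using assms(2,3)
    by (intro trading_cone_subset_attainable[of T]) (simp_all add: trading_cone_def L0_in_def L0_def)
  from attainable_add[OF assms(1) this] show ?thesis by simp
qed

lemma zero_attainable: "(\<lambda>\<omega>. 0) \<in> attainable M F T Q"
  by (rule trading_cone_subset_attainable[OF order_refl trading_cone_zero])

lemma L0_zero_subset_attainable: "L0_zero M (F T) \<subseteq> attainable M F T Q"
proof
  fix X :: "'a \<Rightarrow> real ^ 'b" assume X: "X \<in> L0_zero M (F T)"
  then have "AE \<omega> in M. 0 = X \<omega>" unfolding L0_zero_def by auto
  then show "X \<in> attainable M F T Q"
    by (rule attainable_AE_cong[OF zero_attainable, rotated 2])
      (use X in \<open>auto simp: L0_zero_def L0_def\<close>)
qed


section \<open>The adjusted process\<close>

locale adjusted_market = prob_space M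
  for M :: "'a measure" +
  fixes F :: "nat \<Rightarrow> 'a measure" and T :: nat
    and \<pi> :: "nat \<Rightarrow> 'a \<Rightarrow> real ^ 'n ^ 'n" and B :: "nat \<Rightarrow> 'n \<Rightarrow> 'n \<Rightarrow> 'a set"
  assumes filt: "filtration_upto M F T"
    and process: "bid_ask_process M F T \<pi>"
    and maximal: "maximal_reversible M F T \<pi> B"
begin

abbreviation "P \<equiv> adjusted_process \<pi> B"
abbreviation "A_bar \<equiv> attainable_closure M F T \<pi>"
abbreviation "A_tilde \<equiv> attainable M F T P"

section \<open>Rates of the adjusted process\<close>

lemma subalgebras:
  shows "t \<le> T \<Longrightarrow> subalgebra M (F t)" "s \<le> t \<Longrightarrow> t \<le> T \<Longrightarrow> subalgebra (F t) (F s)"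
  using filt by (auto simp: filtration_upto_def subalgebra_def)

lemma B_reversible: "t \<le> T \<Longrightarrow> B t i j \<in> reversible_sets M F T \<pi> t i j"
  using maximal by (simp add: maximal_reversible_def)

lemma B_sets: "t \<le> T \<Longrightarrow> B t i j \<in> sets (F t)"
  using B_reversible[of t i j] by (simp add: reversible_sets_def)

lemma P_nth:
  "P t \<omega> $ i $ j =
     (if i = j then 1 else if \<omega> \<in> B t j i then 1 / \<pi> t \<omega> $ j $ i else \<pi> t \<omega> $ i $ j)"
  by (auto simp: adjusted_process_def)

lemma \<pi>_measurable: "t \<le> T \<Longrightarrow> (\<lambda>\<omega>. \<pi> t \<omega> $ i $ j) \<in> borel_measurable (F t)"
proof -
  assume "t \<le> T"
  then have "\<pi> t \<in> borel_measurable (F t)" using process by (simp add: bid_ask_process_def)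
  moreover have "(\<lambda>x :: real ^ 'n ^ 'n. x $ i $ j) \<in> borel_measurable borel"
    by (intro borel_measurable_continuous_onI continuous_intros)
  ultimately show ?thesis by (rule measurable_compose)
qed

lemma P_measurable:
  assumes "t \<le> T"
  shows "(\<lambda>\<omega>. P t \<omega> $ i $ j) \<in> borel_measurable (F t)"
proof -
  note [measurable] = \<pi>_measurable[OF assms] B_sets[OF assms]
  show ?thesis unfolding P_nth by measurable
qed

lemma elementary_trade_measurable:
  assumes "t \<le> T"
  shows "(\<lambda>\<omega>. elementary_trade (P t \<omega>) k) \<in> borel_measurable (F t)"
    and "(\<lambda>\<omega>. elementary_trade (\<pi> t \<omega>) k) \<in> borel_measurable (F t)"
proof -
  note [measurable] = \<pi>_measurable[OF assms] P_measurable[OF assms]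
  show "(\<lambda>\<omega>. elementary_trade (P t \<omega>) k) \<in> borel_measurable (F t)"
    "(\<lambda>\<omega>. elementary_trade (\<pi> t \<omega>) k) \<in> borel_measurable (F t)"
    unfolding elementary_trade_def by (cases k; simp add: case_prod_beta)+
qed

lemma \<pi>_facts:
  assumes "t \<le> T" "\<omega> \<in> space M"
  shows "0 < \<pi> t \<omega> $ i $ j" "\<pi> t \<omega> $ i $ i = 1" "1 \<le> \<pi> t \<omega> $ i $ j * \<pi> t \<omega> $ j $ i"
proof -
  have m: "bid_ask_matrix (\<pi> t \<omega>)" using process assms by (simp add: bid_ask_process_def)
  then show "0 < \<pi> t \<omega> $ i $ j" "\<pi> t \<omega> $ i $ i = 1" by (simp_all add: bid_ask_matrix_def)
  have "\<pi> t \<omega> $ i $ i \<le> \<pi> t \<omega> $ i $ j * \<pi> t \<omega> $ j $ i"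
    using m unfolding bid_ask_matrix_def by blast
  then show "1 \<le> \<pi> t \<omega> $ i $ j * \<pi> t \<omega> $ j $ i"
    using \<open>\<pi> t \<omega> $ i $ i = 1\<close> by simp
qed

text \<open>All comparisons rest on
  \<open>1 \<le> \<pi> t \<omega> $ i $ j * \<pi> t \<omega> $ j $ i\<close>. For distinct assets,
  the adjusted round-trip product is 1 on exactly one of the two sets, and the inverse of the
  original product on their intersection.\<close>

lemma P_facts:
  assumes "t \<le> T" "\<omega> \<in> space M"
  shows "0 < P t \<omega> $ i $ j" "P t \<omega> $ i $ j \<le> \<pi> t \<omega> $ i $ j"
    and "\<omega> \<in> B t i j \<union> B t j i \<Longrightarrow> P t \<omega> $ i $ j * P t \<omega> $ j $ i \<le> 1"
proof -
  note \<pi> = \<pi>_facts[OF assms]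
  show "0 < P t \<omega> $ i $ j" using \<pi>(1) by (simp add: P_nth)
  show "P t \<omega> $ i $ j \<le> \<pi> t \<omega> $ i $ j"
    using \<pi>(1)[of j i] \<pi>(2)[of i] \<pi>(3)[of i j] by (auto simp: P_nth field_simps)
  assume "\<omega> \<in> B t i j \<union> B t j i"
  moreover have "\<pi> t \<omega> $ i $ j \<noteq> 0" "\<pi> t \<omega> $ j $ i \<noteq> 0"
    using \<pi>(1)[of i j] \<pi>(1)[of j i] by simp_all
  moreover have "1 / (\<pi> t \<omega> $ i $ j * \<pi> t \<omega> $ j $ i) \<le> 1"
    using \<pi>(3)[of i j] by (simp add: divide_le_eq)
  ultimately show "P t \<omega> $ i $ j * P t \<omega> $ j $ i \<le> 1"
    by (auto simp: P_nth mult.commute)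
qed

text \<open>Adjusting only lowers rates: an exchange at the old rate is one at the new rate followed
  by disposal of the surplus of asset \<open>i\<close>.\<close>

lemma attainable_subset_A_tilde: "attainable M F T \<pi> \<subseteq> A_tilde"
proof -
  have cone: "solvency_cone (\<pi> t \<omega>) \<subseteq> solvency_cone (P t \<omega>)" if "t \<le> T" "\<omega> \<in> space M" for t \<omega>
  proof -
    let ?S = "solvency_cone (P t \<omega>)"
    have axis: "axis i 1 \<in> ?S" for i
      unfolding solvency_cone_def by (rule hull_inc) simp
    have "\<pi> t \<omega> $ i $ j *\<^sub>R axis i 1 - axis j 1 \<in> ?S" for i j
    proof -
      have "P t \<omega> $ i $ j *\<^sub>R axis i 1 - axis j 1 \<in> ?S"
        unfolding solvency_cone_def by (rule hull_inc) blast
      moreover have "(\<pi> t \<omega> $ i $ j - P t \<omega> $ i $ j) *\<^sub>R axis i 1 \<in> ?S"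
        using P_facts(2)[OF that] by (intro convex_cone_scaleR[OF convex_cone_solvency_cone] axis) simp
      ultimately have "(P t \<omega> $ i $ j *\<^sub>R axis i 1 - axis j 1)
          + (\<pi> t \<omega> $ i $ j - P t \<omega> $ i $ j) *\<^sub>R axis i 1 \<in> ?S"
        by (rule convex_cone_add[OF convex_cone_solvency_cone])
      then show ?thesis by (simp add: algebra_simps)
    qed
    then show ?thesis
      unfolding solvency_cone_def[of "\<pi> t \<omega>"] using axis convex_cone_solvency_cone
      by (intro hull_minimal) blast+
  qed
  have "trading_cone M F \<pi> t \<subseteq> trading_cone M F P t" if "t \<le> T" for t
  proof
    fix X assume X: "X \<in> trading_cone M F \<pi> t"
    then have "AE \<omega> in M. X \<omega> \<in> uminus ` solvency_cone (\<pi> t \<omega>)"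
      by (simp add: trading_cone_def L0_in_def)
    with AE_space have "AE \<omega> in M. X \<omega> \<in> uminus ` solvency_cone (P t \<omega>)"
      by eventually_elim (use cone[OF that] in blast)
    then show "X \<in> trading_cone M F P t"
      using X by (simp add: trading_cone_def L0_in_def)
  qed
  then show ?thesis unfolding attainable_def by blast
qed

section \<open>Adjusted trades inside the closure\<close>

lemma A_bar_closed: "ae_closed M (F T) A_bar"
  unfolding attainable_closure_def
  by (rule ae_closed_closure_of_L0[OF prob_space_axioms subalgebras(1)]) simp

lemma A_bar_add: "X \<in> A_bar \<Longrightarrow> Y \<in> A_bar \<Longrightarrow> (\<lambda>\<omega>. X \<omega> + Y \<omega>) \<in> A_bar"
  by (rule attainable_closure_add[OF prob_space_axioms filt])

lemma attainable_imp_A_bar: "X \<in> attainable M F T \<pi> \<Longrightarrow> X \<in> A_bar"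
  using attainable_subset_closure[OF prob_space_axioms filt] by blast

text \<open>Additivity gives integer multiples of a reversed trade; adding attainable forward trades
  then trims them to other coefficients.\<close>

lemma A_bar_of_nat_mult: "X \<in> A_bar \<Longrightarrow> (\<lambda>\<omega>. real n *\<^sub>R X \<omega>) \<in> A_bar"
proof (induction n)
  case 0
  then show ?case using attainable_imp_A_bar[OF zero_attainable] by simp
next
  case (Suc n)
  show ?case using A_bar_add[OF Suc.IH[OF Suc.prems] Suc.prems] by (simp add: algebra_simps)
qed

lemma exchange_eq: "exchange Q t i j \<omega> = elementary_trade (Q t \<omega>) (Inr (i, j))"
  by (simp add: exchange_def elementary_trade_simps)

lemma L0_scaleR_trade:
  assumes "t \<le> T" "\<alpha> \<in> borel_measurable (F t)"
  shows "(\<lambda>\<omega>. \<alpha> \<omega> *\<^sub>R elementary_trade (P t \<omega>) k) \<in> L0 (F T)"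
    "(\<lambda>\<omega>. \<alpha> \<omega> *\<^sub>R elementary_trade (\<pi> t \<omega>) k) \<in> L0 (F T)"
  unfolding L0_def using assms elementary_trade_measurable[OF assms(1), of k]
  by (auto intro!: measurable_from_subalg[OF subalgebras(2)[OF assms(1) order_refl]] borel_measurable_scaleR)

text \<open>Reversal is given only with coefficient 1 on \<open>D\<close>. Reversing
  \<open>n\<close> units and trading \<open>n - min (\<alpha> \<omega>) n\<close> of them forward
  leaves the truncated coefficient, and \<open>n\<close> tends to infinity.\<close>

lemma reversed_trade_in_A_bar:
  assumes t: "t \<le> T" and D: "D \<in> reversible_sets M F T \<pi> t i j"
    and [measurable]: "\<alpha> \<in> borel_measurable (F t)" and nonneg: "AE \<omega> in M. 0 \<le> \<alpha> \<omega>"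
  shows "(\<lambda>\<omega>. - (\<alpha> \<omega> * indicator D \<omega>) *\<^sub>R elementary_trade (\<pi> t \<omega>) (Inr (i, j))) \<in> A_bar"
proof (rule ae_closedD[OF A_bar_closed])
  let ?z = "\<lambda>\<omega>. elementary_trade (\<pi> t \<omega>) (Inr (i, j))"
  have [measurable]: "D \<in> sets (F t)" using D by (simp add: reversible_sets_def)
  have "(\<lambda>\<omega>. - (indicator D \<omega> *\<^sub>R ?z \<omega>)) \<in> A_bar"
    using D by (simp add: reversible_sets_def exchange_eq)
  from A_bar_of_nat_mult[OF this] have 1: "(\<lambda>\<omega>. real n *\<^sub>R - (indicator D \<omega> *\<^sub>R ?z \<omega>)) \<in> A_bar" for n .
  have 2: "(\<lambda>\<omega>. ((real n - min (\<alpha> \<omega>) (real n)) * indicator D \<omega>) *\<^sub>R ?z \<omega>) \<in> A_bar" for n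
    by (intro attainable_imp_A_bar scaled_trade_attainable t elementary_trade_measurable)
      (auto simp: indicator_def)
  show "(\<lambda>\<omega>. - (min (\<alpha> \<omega>) (real n) * indicator D \<omega>) *\<^sub>R ?z \<omega>) \<in> A_bar" for n
    using A_bar_add[OF 1 2, of n n] by (simp add: algebra_simps)
  show "(\<lambda>\<omega>. - (\<alpha> \<omega> * indicator D \<omega>) *\<^sub>R ?z \<omega>) \<in> L0 (F T)"
    by (intro L0_scaleR_trade t) measurable
  show "AE \<omega> in M. (\<lambda>n. - (min (\<alpha> \<omega>) (real n) * indicator D \<omega>) *\<^sub>R ?z \<omega>)
      \<longlonglongrightarrow> - (\<alpha> \<omega> * indicator D \<omega>) *\<^sub>R ?z \<omega>"
  proof (intro AE_I2 tendsto_eventually)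
    fix \<omega>
    obtain N :: nat where "\<alpha> \<omega> \<le> real N" using real_arch_simple by blast
    then have "\<forall>\<^sub>F n in sequentially. \<alpha> \<omega> \<le> real n"
      by (auto simp: eventually_sequentially intro!: exI[of _ N] elim: order_trans)
    then show "\<forall>\<^sub>F n in sequentially. - (min (\<alpha> \<omega>) (real n) * indicator D \<omega>) *\<^sub>R ?z \<omega>
        = - (\<alpha> \<omega> * indicator D \<omega>) *\<^sub>R ?z \<omega>"
      by eventually_elim simp
  qed
qed

text \<open>On \<open>B t j i\<close> the adjusted exchange from \<open>i\<close> to
  \<open>j\<close> is the reversed original exchange from \<open>j\<close> to \<open>i\<close>,
  scaled by \<open>1 / \<pi> t \<omega> $ j $ i\<close>; elsewhere it is the original
  exchange.\<close>

lemma adjusted_trade_in_A_bar: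
  assumes t: "t \<le> T" and [measurable]: "\<alpha> \<in> borel_measurable (F t)" and nonneg: "\<And>\<omega>. 0 \<le> \<alpha> \<omega>"
  shows "(\<lambda>\<omega>. \<alpha> \<omega> *\<^sub>R elementary_trade (P t \<omega>) k) \<in> A_bar"
proof -
  note [measurable] = \<pi>_measurable[OF t] B_sets[OF t]
  have trade: "(\<lambda>\<omega>. \<beta> \<omega> *\<^sub>R elementary_trade (\<pi> t \<omega>) k) \<in> A_bar"
    if "\<beta> \<in> borel_measurable (F t)" "\<And>\<omega>. 0 \<le> \<beta> \<omega>" for \<beta> k
    using that by (intro attainable_imp_A_bar scaled_trade_attainable t elementary_trade_measurable) auto
  consider i where "k = Inl i" | i where "k = Inr (i, i)" | i j where "k = Inr (i, j)" "i \<noteq> j"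
    by (metis sum.exhaust surj_pair)
  then show ?thesis
  proof cases
    case 1
    then show ?thesis using trade[of \<alpha> k] nonneg by (simp add: elementary_trade_simps)
  next
    case 2
    then show ?thesis
      using attainable_imp_A_bar[OF zero_attainable] by (simp add: elementary_trade_simps P_nth)
  next
    case 3
    let ?z = "\<lambda>i j \<omega>. elementary_trade (\<pi> t \<omega>) (Inr (i, j))"
    have 1: "(\<lambda>\<omega>. (\<alpha> \<omega> * indicator (- B t j i) \<omega>) *\<^sub>R ?z i j \<omega>) \<in> A_bar"
      using nonneg by (intro trade) (auto simp: indicator_compl)
    have "AE \<omega> in M. 0 \<le> \<alpha> \<omega> / \<pi> t \<omega> $ j $ i"
      using AE_space by eventually_elim (use nonneg \<pi>_facts(1)[OF t] in \<open>auto intro: divide_nonneg_pos\<close>)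
    then have 2: "(\<lambda>\<omega>. - (\<alpha> \<omega> / \<pi> t \<omega> $ j $ i * indicator (B t j i) \<omega>) *\<^sub>R ?z j i \<omega>) \<in> A_bar"
      by (intro reversed_trade_in_A_bar t B_reversible) auto
    show ?thesis
    proof (rule ae_closed_AE_cong[OF A_bar_closed A_bar_add[OF 1 2] L0_scaleR_trade(1)[OF t]])
      show "AE \<omega> in M. (\<alpha> \<omega> * indicator (- B t j i) \<omega>) *\<^sub>R ?z i j \<omega> +
          - (\<alpha> \<omega> / \<pi> t \<omega> $ j $ i * indicator (B t j i) \<omega>) *\<^sub>R ?z j i \<omega> =
          \<alpha> \<omega> *\<^sub>R elementary_trade (P t \<omega>) k"
        using AE_space
      proof eventually_elim
        case (elim \<omega>)
        have "\<pi> t \<omega> $ j $ i \<noteq> 0" using \<pi>_facts(1)[OF t elim, of j i] by simp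
        then show ?case
          using 3(2) by (auto simp: 3(1) elementary_trade_simps P_nth indicator_def algebra_simps)
      qed
    qed measurable
  qed
qed

lemma A_tilde_subset_A_bar: "A_tilde \<subseteq> A_bar"
  by (rule attainable_subset_ae_closed[OF filt elementary_trade_measurable(1) A_bar_closed
        attainable_imp_A_bar[OF zero_attainable] A_bar_add adjusted_trade_in_A_bar])

section \<open>Lines and rays of the adjusted market\<close>

lemma adjusted_trade_in_A_tilde:
  assumes "t \<le> T" "\<alpha> \<in> borel_measurable (F t)" "AE \<omega> in M. 0 \<le> \<alpha> \<omega>"
  shows "(\<lambda>\<omega>. \<alpha> \<omega> *\<^sub>R elementary_trade (P t \<omega>) k) \<in> A_tilde"
  using assms by (intro scaled_trade_attainable elementary_trade_measurable)

text \<open>Symmetric in the two assets: \<open>B t i j\<close> lowers the rate from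
  \<open>j\<close> to \<open>i\<close> and \<open>B t j i\<close> the opposite one, and either makes
  both directions reversible in the adjusted market.\<close>

definition reversible_region :: "nat \<Rightarrow> 'n + 'n \<times> 'n \<Rightarrow> 'a set" where
  "reversible_region t k = (case k of Inl i \<Rightarrow> {} | Inr (i, j) \<Rightarrow> B t i j \<union> B t j i)"

lemma reversible_region_simps:
  "reversible_region t (Inl i) = {}"
  "reversible_region t (Inr (i, j)) = B t i j \<union> B t j i"
  by (simp_all add: reversible_region_def)

lemma reversible_region_sets: "t \<le> T \<Longrightarrow> reversible_region t k \<in> sets (F t)"
  using B_sets by (auto simp: reversible_region_def split: sum.split)

text \<open>With \<open>p\<close>, \<open>q\<close> the adjusted rates from \<open>i\<close> to
  \<open>j\<close> and back, \<open>p e_i - e_j = p (e_i - q e_j) - (1 - p q) e_j\<close>: the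
  opposite exchange plus a disposal, which is allowed since \<open>p q \<le> 1\<close> on the
  region.\<close>

lemma reversed_adjusted_trade_in_A_tilde:
  assumes t: "t \<le> T" and [measurable]: "\<alpha> \<in> borel_measurable (F t)" and nonneg: "\<And>\<omega>. 0 \<le> \<alpha> \<omega>"
  shows "(\<lambda>\<omega>. - (\<alpha> \<omega> * indicator (reversible_region t k) \<omega>) *\<^sub>R elementary_trade (P t \<omega>) k) \<in> A_tilde"
proof (cases k)
  case (Inl i)
  then show ?thesis using zero_attainable by (simp add: reversible_region_simps)
next
  case (Inr p)
  obtain i j where k: "k = Inr (i, j)" using Inr by (cases p) auto
  let ?D = "reversible_region t k"
  note [measurable] = P_measurable[OF t] reversible_region_sets[OF t]
  let ?\<beta> = "\<lambda>\<omega>. \<alpha> \<omega> * indicator ?D \<omega> * P t \<omega> $ i $ j"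
  let ?\<gamma> = "\<lambda>\<omega>. \<alpha> \<omega> * indicator ?D \<omega> * (1 - P t \<omega> $ i $ j * P t \<omega> $ j $ i)"
  have "AE \<omega> in M. 0 \<le> ?\<beta> \<omega>"
    using AE_space
    by eventually_elim (use nonneg P_facts(1)[OF t] in \<open>simp add: less_imp_le\<close>)
  then have 1: "(\<lambda>\<omega>. ?\<beta> \<omega> *\<^sub>R elementary_trade (P t \<omega>) (Inr (j, i))) \<in> A_tilde"
    by (intro adjusted_trade_in_A_tilde t) measurable
  have "AE \<omega> in M. 0 \<le> ?\<gamma> \<omega>"
    using AE_space
  proof eventually_elim
    case (elim \<omega>)
    show ?case
      using nonneg P_facts(3)[OF t elim, of i j]
      by (cases "\<omega> \<in> ?D") (simp_all add: k reversible_region_simps)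
  qed
  then have 2: "(\<lambda>\<omega>. ?\<gamma> \<omega> *\<^sub>R elementary_trade (P t \<omega>) (Inl j)) \<in> A_tilde"
    by (intro adjusted_trade_in_A_tilde t) measurable
  have "(\<lambda>\<omega>. ?\<beta> \<omega> *\<^sub>R elementary_trade (P t \<omega>) (Inr (j, i)) +
      ?\<gamma> \<omega> *\<^sub>R elementary_trade (P t \<omega>) (Inl j)) =
    (\<lambda>\<omega>. - (\<alpha> \<omega> * indicator ?D \<omega>) *\<^sub>R elementary_trade (P t \<omega>) k)"
    by (simp add: fun_eq_iff k elementary_trade_simps algebra_simps)
  then show ?thesis using attainable_add[OF 1 2] by simp
qed

text \<open>A reversible coefficient, however small, can be amplified to coefficient 1 on its
  support. That support would enlarge \<open>B t i j\<close>, so by maximality it is null.\<close>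

lemma irreversible_trade_null:
  assumes t: "t \<le> T" and [measurable]: "\<alpha> \<in> borel_measurable (F t)" and nonneg: "\<And>\<omega>. 0 \<le> \<alpha> \<omega>"
    and "i \<noteq> j"
    and rev: "(\<lambda>\<omega>. - (\<alpha> \<omega> * indicator (- (B t i j \<union> B t j i)) \<omega>) *\<^sub>R
      elementary_trade (P t \<omega>) (Inr (i, j))) \<in> A_bar"
  shows "AE \<omega> in M. \<alpha> \<omega> * indicator (- (B t i j \<union> B t j i)) \<omega> = 0"
proof -
  note [measurable] = B_sets[OF t]
  let ?z = "\<lambda>\<omega>. elementary_trade (\<pi> t \<omega>) (Inr (i, j))"
  define \<beta> where "\<beta> \<omega> = \<alpha> \<omega> * indicator (- (B t i j \<union> B t j i)) \<omega>" for \<omega>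
  have [measurable]: "\<beta> \<in> borel_measurable (F t)" unfolding \<beta>_def indicator_compl by measurable
  have \<beta>: "0 \<le> \<beta> \<omega>" for \<omega> using nonneg by (simp add: \<beta>_def)
  define C where "C = {\<omega> \<in> space (F t). 0 < \<beta> \<omega>}"
  have [measurable]: "C \<in> sets (F t)" unfolding C_def by measurable
  have space: "space (F t) = space M" using subalgebras(1)[OF t] by (simp add: subalgebra_def)
  have "(\<lambda>\<omega>. - \<beta> \<omega> *\<^sub>R ?z \<omega>) \<in> A_bar"
  \<comment> \<open>Off \<open>B t j i\<close> the adjusted rate from \<open>i\<close> to
    \<open>j\<close> is the original one, so the original trade is being reversed.\<close>
  proof (rule back_subst[of "\<lambda>X. X \<in> A_bar", OF rev], rule ext)
    fix \<omega>
    show "- (\<alpha> \<omega> * indicator (- (B t i j \<union> B t j i)) \<omega>) *\<^sub>R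
      elementary_trade (P t \<omega>) (Inr (i, j)) = - \<beta> \<omega> *\<^sub>R ?z \<omega>"
      using \<open>i \<noteq> j\<close> by (simp add: \<beta>_def elementary_trade_simps P_nth indicator_def)
  qed
  from A_bar_of_nat_mult[OF this] have 1: "(\<lambda>\<omega>. real n *\<^sub>R (- \<beta> \<omega> *\<^sub>R ?z \<omega>)) \<in> A_bar" for n .
  \<comment> \<open>Forward trades cut the reversed coefficient \<open>n * \<beta>\<close> down to
    \<open>min (n * \<beta>) 1\<close>, which converges to the indicator of
    \<open>C\<close>.\<close>
  have 2: "(\<lambda>\<omega>. (real n * \<beta> \<omega> - min (real n * \<beta> \<omega>) 1) *\<^sub>R ?z \<omega>) \<in> A_bar" for n
    by (intro attainable_imp_A_bar scaled_trade_attainable t elementary_trade_measurable) auto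
  have "(\<lambda>\<omega>. - indicator C \<omega> *\<^sub>R ?z \<omega>) \<in> A_bar"
  proof (rule ae_closedD[OF A_bar_closed])
    show "(\<lambda>\<omega>. - min (real n * \<beta> \<omega>) 1 *\<^sub>R ?z \<omega>) \<in> A_bar" for n
      using A_bar_add[OF 1 2, of n n] by (simp add: algebra_simps)
    show "(\<lambda>\<omega>. - indicator C \<omega> *\<^sub>R ?z \<omega>) \<in> L0 (F T)"
      by (intro L0_scaleR_trade t) measurable
    have "(\<lambda>n. - min (real n * \<beta> \<omega>) 1 *\<^sub>R ?z \<omega>) \<longlonglongrightarrow> - indicator C \<omega> *\<^sub>R ?z \<omega>"
      if "\<omega> \<in> space M" for \<omega>
    proof (rule tendsto_eventually, cases "0 < \<beta> \<omega>")
      case True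
      obtain N :: nat where N: "1 / \<beta> \<omega> \<le> real N" using real_arch_simple by blast
      have "1 \<le> real n * \<beta> \<omega>" if "N \<le> n" for n
      proof -
        have "1 / \<beta> \<omega> \<le> real n" using N that by simp
        then show ?thesis using True by (simp add: divide_le_eq)
      qed
      then have "\<forall>\<^sub>F n in sequentially. 1 \<le> real n * \<beta> \<omega>"
        unfolding eventually_sequentially by blast
      then show "\<forall>\<^sub>F n in sequentially. - min (real n * \<beta> \<omega>) 1 *\<^sub>R ?z \<omega> = - indicator C \<omega> *\<^sub>R ?z \<omega>"
        by eventually_elim (use True that in \<open>simp add: C_def space\<close>)
    next
      case False
      then have "\<beta> \<omega> = 0" using \<beta>[of \<omega>] by simp
      then show "\<forall>\<^sub>F n in sequentially. - min (real n * \<beta> \<omega>) 1 *\<^sub>R ?z \<omega> = - indicator C \<omega> *\<^sub>R ?z \<omega>"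
        by (simp add: C_def)
    qed
    then show "AE \<omega> in M. (\<lambda>n. - min (real n * \<beta> \<omega>) 1 *\<^sub>R ?z \<omega>) \<longlonglongrightarrow> - indicator C \<omega> *\<^sub>R ?z \<omega>"
      by (rule AE_I2)
  qed
  then have "C \<in> reversible_sets M F T \<pi> t i j"
    by (simp add: reversible_sets_def exchange_eq)
  then have "B t i j \<union> C \<in> reversible_sets M F T \<pi> t i j"
    by (rule reversible_Un[OF prob_space_axioms filt process t B_reversible[OF t]])
  then have "prob ((B t i j \<union> C) - B t i j) = 0"
    using maximal t unfolding maximal_reversible_def by blast
  \<comment> \<open>\<beta> vanishes on \<open>B t i j\<close>, so all of \<open>C\<close> is new
    and maximality bounds its full probability.\<close>
  moreover have "(B t i j \<union> C) - B t i j = C"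
    by (auto simp: C_def \<beta>_def indicator_def split: if_splits)
  ultimately have "prob C = 0" by simp
  moreover have "C \<in> sets M" using subalgebras(1)[OF t] \<open>C \<in> sets (F t)\<close> by (auto simp: subalgebra_def)
  ultimately have "AE \<omega> in M. \<omega> \<notin> C"
    by (intro AE_not_in) (simp add: null_setsI emeasure_eq_measure)
  then show ?thesis
    using AE_space
  proof eventually_elim
    case (elim \<omega>)
    then have "\<not> 0 < \<beta> \<omega>" by (simp add: C_def space)
    then show ?case using \<beta>[of \<omega>] by (simp add: \<beta>_def)
  qed
qed

text \<open>The flag \<open>True\<close> selects the line (on the reversible region), \<open>False\<close> the ray (off it).\<close>

definition trade_part :: "nat \<Rightarrow> 'n + 'n \<times> 'n \<Rightarrow> bool \<Rightarrow> 'a \<Rightarrow> real ^ 'n" where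
  "trade_part t k b \<omega> =
     indicator (if b then reversible_region t k else - reversible_region t k) \<omega> *\<^sub>R
       elementary_trade (P t \<omega>) k"

definition generator ::
  "nat \<times> ('n + 'n \<times> 'n) \<times> bool \<Rightarrow> 'a measure \<times> ('a \<Rightarrow> real ^ 'n) \<times> bool" where
  "generator = (\<lambda>(t, k, b). (F t, trade_part t k b, b))"

lemma trade_part_measurable:
  assumes "t \<le> T"
  shows "trade_part t k b \<in> borel_measurable (F T)"
proof -
  note [measurable] = reversible_region_sets[OF assms] elementary_trade_measurable(1)[OF assms]
  have "(\<lambda>\<omega>. trade_part t k b \<omega>) \<in> borel_measurable (F t)"
    by (cases b) (simp_all add: trade_part_def indicator_compl)
  then show ?thesis by (rule measurable_from_subalg[OF subalgebras(2)[OF assms order_refl]])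
qed

lemma chronological_generators:
  assumes "sorted_wrt (\<lambda>p q. fst p \<le> fst q) l" "\<forall>p\<in>set l. fst p \<le> T"
  shows "chronological (F T) (map generator l)"
  using assms
proof (induction l)
  case (Cons p l)
  obtain t k b where p: "p = (t, k, b)" by (cases p)
  then have "t \<le> T" using Cons.prems by simp
  have "subalgebra (fst (generator q)) (F t)" if "q \<in> set l" for q
    using Cons.prems that by (cases q) (auto simp: p generator_def intro!: subalgebras(2))
  then show ?case
    using Cons trade_part_measurable[OF \<open>t \<le> T\<close>, of k b] subalgebras(2)[OF \<open>t \<le> T\<close> order_refl]
    by (simp add: p generator_def)
qed simp

text \<open>The finite index set is sorted by date; ties are harmless because entries of equal date
  share a \<sigma>-algebra.\<close>

lemma generators_exist:
  obtains l where "chronological (F T) (map generator l)" "set l = {..T} \<times> UNIV"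
proof -
  have "finite ({..T} \<times> (UNIV :: (('n + 'n \<times> 'n) \<times> bool) set))" by simp
  then obtain xs where xs: "set xs = {..T} \<times> (UNIV :: (('n + 'n \<times> 'n) \<times> bool) set)"
    using finite_list by blast
  have "sorted (map fst (sort_key fst xs))" by simp
  then have "sorted_wrt (\<lambda>p q. fst p \<le> fst q) (sort_key fst xs)" by (simp only: sorted_map)
  then have "chronological (F T) (map generator (sort_key fst xs))"
    by (rule chronological_generators) (auto simp: xs)
  then show ?thesis by (rule that) (simp add: xs)
qed

lemma trade_part_in_A_tilde:
  assumes t: "t \<le> T" and [measurable]: "\<alpha> \<in> borel_measurable (F t)" and b: "b \<or> (\<forall>\<omega>. 0 \<le> \<alpha> \<omega>)"
  shows "(\<lambda>\<omega>. \<alpha> \<omega> *\<^sub>R trade_part t k b \<omega>) \<in> A_tilde"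
proof -
  note [measurable] = reversible_region_sets[OF t]
  let ?D = "reversible_region t k" and ?z = "\<lambda>\<omega>. elementary_trade (P t \<omega>) k"
  show ?thesis
  proof (cases b)
    case True
    \<comment> \<open>On a line the positive part of the coefficient is traded forward and the
      negative part backward.\<close>
    have 1: "(\<lambda>\<omega>. (max (\<alpha> \<omega>) 0 * indicator ?D \<omega>) *\<^sub>R ?z \<omega>) \<in> A_tilde"
      by (intro adjusted_trade_in_A_tilde t) auto
    have 2: "(\<lambda>\<omega>. - (max (- \<alpha> \<omega>) 0 * indicator ?D \<omega>) *\<^sub>R ?z \<omega>) \<in> A_tilde"
      by (intro reversed_adjusted_trade_in_A_tilde t) auto
    have "(\<lambda>\<omega>. (max (\<alpha> \<omega>) 0 * indicator ?D \<omega>) *\<^sub>R ?z \<omega> + - (max (- \<alpha> \<omega>) 0 * indicator ?D \<omega>) *\<^sub>R ?z \<omega>)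
        = (\<lambda>\<omega>. \<alpha> \<omega> *\<^sub>R trade_part t k b \<omega>)"
      by (auto simp: fun_eq_iff True trade_part_def max_def)
    then show ?thesis using attainable_add[OF 1 2] by simp
  next
    case False
    then have "(\<lambda>\<omega>. (\<alpha> \<omega> * indicator (- ?D) \<omega>) *\<^sub>R ?z \<omega>) \<in> A_tilde"
      using b by (intro adjusted_trade_in_A_tilde t) (auto simp: indicator_compl)
    then show ?thesis using False by (simp add: trade_part_def)
  qed
qed

text \<open>A reversed disposal is a nonnegative claim, hence null without arbitrage. An exchange of
  an asset for itself is zero at rate 1. An irreversible exchange is null by maximality, as adjusted
  claims lie in the closure.\<close>

lemma A_tilde_ray_null:
  assumes af: "arbitrage_free M (F T) A_tilde"
    and t: "t \<le> T" and \<alpha>[measurable]: "\<alpha> \<in> borel_measurable (F t)" and nonneg: "\<And>\<omega>. 0 \<le> \<alpha> \<omega>"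
    and rev: "(\<lambda>\<omega>. - (\<alpha> \<omega> *\<^sub>R trade_part t k False \<omega>)) \<in> A_tilde"
  shows "AE \<omega> in M. \<alpha> \<omega> *\<^sub>R trade_part t k False \<omega> = 0"
proof -
  consider i where "k = Inl i" | i where "k = Inr (i, i)" | i j where "k = Inr (i, j)" "i \<noteq> j"
    by (metis sum.exhaust surj_pair)
  then show ?thesis
  proof cases
    case (1 i)
    have eq: "\<alpha> \<omega> *\<^sub>R trade_part t k False \<omega> = - (\<alpha> \<omega> *\<^sub>R axis i 1)" for \<omega>
      by (simp add: 1 trade_part_def reversible_region_simps elementary_trade_simps)
    have "(\<lambda>\<omega>. \<alpha> \<omega> *\<^sub>R axis i 1) \<in> A_tilde" using rev unfolding eq by simp
    moreover from this have "(\<lambda>\<omega>. \<alpha> \<omega> *\<^sub>R axis i 1) \<in> L0_nonneg M (F T)"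
      using attainable_subset_L0[OF filt] nonneg by (auto simp: L0_nonneg_def axis_def)
    ultimately have "(\<lambda>\<omega>. \<alpha> \<omega> *\<^sub>R axis i 1) \<in> (L0_zero M (F T) :: ('a \<Rightarrow> real ^ 'n) set)"
      using af unfolding arbitrage_free_def by blast
    then have "AE \<omega> in M. \<alpha> \<omega> *\<^sub>R axis i (1::real) = (0 :: real ^ 'n)" unfolding L0_zero_def by blast
    then show ?thesis unfolding eq by eventually_elim simp
  next
    case (2 i)
    then show ?thesis by (simp add: trade_part_def elementary_trade_simps P_nth)
  next
    case (3 i j)
    have eq: "\<alpha> \<omega> *\<^sub>R trade_part t k False \<omega> =
        (\<alpha> \<omega> * indicator (- (B t i j \<union> B t j i)) \<omega>) *\<^sub>R elementary_trade (P t \<omega>) (Inr (i, j))" for \<omega>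
      by (simp add: 3(1) trade_part_def reversible_region_simps)
    have "AE \<omega> in M. \<alpha> \<omega> * indicator (- (B t i j \<union> B t j i)) \<omega> = 0"
      using rev A_tilde_subset_A_bar unfolding eq
      by (intro irreversible_trade_null t \<alpha> nonneg 3(2)) auto
    then show ?thesis unfolding eq by eventually_elim simp
  qed
qed

text \<open>The claims turn out to be the sum of all lines and rays. Closedness of that sum comes
  before the equality, because attainable claims are reached only as limits of combinations with
  measurable coefficients.\<close>

lemma closedin_A_tilde:
  assumes "arbitrage_free M (F T) A_tilde"
  shows "closedin (L0_topology M (F T)) A_tilde"
proof -
  obtain l where chron: "chronological (F T) (map generator l)" and l: "set l = {..T} \<times> UNIV"
    by (rule generators_exist)
  let ?S = "gen_cone M (F T) (map generator l)"
  have set: "\<exists>t k. t \<le> T \<and> G = F t \<and> g = trade_part t k b"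
    if "(G, g, b) \<in> set (map generator l)" for G g b
    using that by (auto simp: l generator_def)
  have S: "?S \<subseteq> A_tilde"
  proof (rule gen_cone_subset[OF L0_zero_subset_attainable attainable_add])
    show "(\<lambda>\<omega>. \<alpha> \<omega> *\<^sub>R g \<omega>) \<in> A_tilde"
      if "(G, g, b) \<in> set (map generator l)" "\<alpha> \<in> borel_measurable G" "b \<or> (\<forall>\<omega>. 0 \<le> \<alpha> \<omega>)" for G g b \<alpha>
      using set[OF that(1)] that(2,3) trade_part_in_A_tilde by blast
  qed
  have closed: "ae_closed M (F T) ?S"
  \<comment> \<open>\<open>W\<close> is the set of all adjusted claims, so rays are tested against
    every strategy.\<close>
  proof (rule ae_closed_gen_cone[OF chron attainable_add S])
    show "AE \<omega> in M. \<alpha> \<omega> *\<^sub>R g \<omega> = 0"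
      if "(G, g, False) \<in> set (map generator l)" "\<alpha> \<in> borel_measurable G" "\<And>\<omega>. 0 \<le> \<alpha> \<omega>"
        "(\<lambda>\<omega>. - (\<alpha> \<omega> *\<^sub>R g \<omega>)) \<in> A_tilde" for G g \<alpha>
      using set[OF that(1)] that(2-4) A_tilde_ray_null[OF assms] by blast
  qed
  have "A_tilde \<subseteq> ?S"
  proof (rule attainable_subset_ae_closed[OF filt elementary_trade_measurable(1) closed gen_cone_zero gen_cone_add])
    fix t k and \<alpha> :: "'a \<Rightarrow> real"
    assume t: "t \<le> T" and \<alpha>: "\<alpha> \<in> borel_measurable (F t)" "\<And>\<omega>. 0 \<le> \<alpha> \<omega>"
    have "(F t, trade_part t k b, b) \<in> set (map generator l)" for b
      using t by (auto simp: l generator_def intro!: image_eqI[of _ _ "(t, k, b)"])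
    then have "(\<lambda>\<omega>. \<alpha> \<omega> *\<^sub>R trade_part t k b \<omega>) \<in> ?S" for b
      using \<alpha> by (intro gen_cone_generator) auto
    \<comment> \<open>A trade is its restriction to the reversible region plus the rest.\<close>
    from gen_cone_add[OF this[of True] this[of False]]
    show "(\<lambda>\<omega>. \<alpha> \<omega> *\<^sub>R elementary_trade (P t \<omega>) k) \<in> ?S"
      by (rule back_subst[of "\<lambda>X. X \<in> ?S"]) (auto simp: fun_eq_iff trade_part_def indicator_def)
  qed
  with S have "A_tilde = ?S" by blast
  then show ?thesis
    using closed attainable_subset_L0[OF filt, of P]
    by (intro closedin_L0_topologyI[OF prob_space_axioms subalgebras(1)]) simp_all
qed

text \<open>Freedom from arbitrage is an equality with \<open>L0_zero\<close>, so besides the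
  inclusion in the closure it matters that null claims are already adjusted claims: a violation must
  then be a nonnegative claim that is not null.\<close>

lemma A_bar_arbitrage:
  assumes "contains_arbitrage M (F T) A_tilde"
  shows "contains_arbitrage M (F T) A_bar"
proof -
  have "L0_zero M (F T) \<subseteq> (L0_nonneg M (F T) :: ('a \<Rightarrow> real ^ 'n) set)"
    by (auto simp: L0_zero_def L0_nonneg_def)
  then show ?thesis using assms A_tilde_subset_A_bar L0_zero_subset_attainable[of M F T P]
    unfolding arbitrage_free_def by blast
qed

end

theorem theorem1p2:
  fixes M :: "'a measure" and F :: "nat \<Rightarrow> 'a measure" and T :: nat
    and \<pi> :: "nat \<Rightarrow> 'a \<Rightarrow> real ^ 'n ^ 'n" and B :: "nat \<Rightarrow> 'n \<Rightarrow> 'n \<Rightarrow> 'a set"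
  assumes "prob_space M"
    and "filtration_upto M F T"
    and "bid_ask_process M F T \<pi>"
    and "maximal_reversible M F T \<pi> B"
  shows "let A = attainable M F T \<pi>;
             A_bar = attainable_closure M F T \<pi>;
             A_tilde = attainable M F T (adjusted_process \<pi> B)
         in A \<subseteq> A_tilde \<and> A_tilde \<subseteq> A_bar \<and>
            (contains_arbitrage M (F T) A_tilde \<or>
              (arbitrage_free M (F T) A_tilde \<and> closedin (L0_topology M (F T)) A_tilde)) \<and>
            (contains_arbitrage M (F T) A_tilde \<longrightarrow> contains_arbitrage M (F T) A_bar) \<and>
            (arbitrage_free M (F T) A_tilde \<and> closedin (L0_topology M (F T)) A_tilde \<longrightarrow>
              A_bar = A_tilde)"
proof -
  interpret adjusted_market M F T \<pi> B
    by (intro adjusted_market.intro adjusted_market_axioms.intro assms)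
  have "A_bar \<subseteq> A_tilde" if "closedin (L0_topology M (F T)) A_tilde"
    unfolding attainable_closure_def
    by (rule closure_of_minimal[OF attainable_subset_A_tilde that])
  then show ?thesis
    unfolding Let_def
    using attainable_subset_A_tilde A_tilde_subset_A_bar closedin_A_tilde A_bar_arbitrage by blast
qed

end
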